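(* Let $f$ be a pairwise social choice correspondence (SCC) that satisfies non-imposition, homogeneity, and neutrality. Then $f$ is (Fishburn-)strategyproof if and only if $f$ is a robust dominant set rule.
   Context: Let $\mathbb{N}=\{1,2,\dots\}$ be the set of potential voters and $A$ a finite set of $m$ alternatives. An electorate is a finite non-empty $N\subseteq\mathbb{N}$; each voter $i\in N$ has a strict total order $\succ_i$ on $A$. A preference profile is $R\in\mathcal{R}(A)^N$ for some electorate $N$, where $\mathcal{R}(A)$ is the set of strict total orders on $A$; $\mathcal{R}^*(A)$ is the set of all profiles over all electorates. The majority margin is $g_R(x,y)=|\{i\in N: x\succ_i y\}|-|\{i\in N: y\succ_i x\}|$; $x\succsim_R y$ iff $g_R(x,y)\ge 0$, with strict part $\succ_R$. For sets, $X\succ Y$ means $x\succ y$ for all $x\in X,y\in Y$. A non-empty $X\subseteq A$ is dominant in $R$ if $X\succ_R A\setminus X$. An SCC is a map $f:\mathcal{R}^*(A)\to 2^A\setminus\{\emptyset\}$. $f$ is pairwise if $f(R)=f(R')$ whenever $g_R=g_{R'}$. $f$ is non-imposing if for every $x\in A$ some profile $R$ has $f(R)=\{x\}$. $f$ is neutral if for every electorate $N$, profiles $R,R'\in\mathcal{R}(A)^N$ and permutation $\pi$ of $A$ with $x\succ_i y\iff \pi(x)\succ'_i\pi(y)$ for all $x,y,i$, we have $f(R')=\pi(f(R))$. $f$ is homogeneous if $f(kR)=f(R)$ for every profile $R$ and $k\ge1$, where $kR$ consists of $k$ copies of $R$. Fishburn's extension: for $X\neq Y$, $X\succ_i^F Y$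 iff $X\setminus Y\succ_i Y$ and $X\succ_i Y\setminus X$. $f$ is strategyproof if there is no electorate $N$, voter $i\in N$ and profiles $R,R'\in\mathcal{R}(A)^N$ with $\succ_j=\succ'_j$ for all $j\ne i$ and $f(R')\succ_i^F f(R)$. $f$ is a dominant set rule if $f(R)$ is dominant in $R$ for every profile $R$; it is robust if $f(R')\subseteq f(R)$ for all profiles $R,R'$ such that $f(R)$ is dominant in $R'$. *)

theory Defs
  imports Main
begin

text \<open>Alternatives: a finite type 'a (the set A = UNIV).  Voters are natural
numbers; 0 is excluded so that potential voters are {1,2,...}.
A profile maps each voter of its electorate N = dom R to a strict total order
(as a relation: (x,y) in the relation means x is strictly preferred to y);
voters outside the electorate are mapped to None.\<close>

type_synonym 'a profile = "nat \<Rightarrow> 'a rel option"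

definition electorate :: "'a profile \<Rightarrow> nat set" where
  "electorate R = dom R"

definition pref :: "'a profile \<Rightarrow> nat \<Rightarrow> 'a rel" where
  "pref R i = the (R i)"

definition valid_profile :: "'a profile \<Rightarrow> bool" where
  "valid_profile R \<longleftrightarrow> finite (dom R) \<and> dom R \<noteq> {} \<and> 0 \<notin> dom R \<and>
     (\<forall>i\<in>dom R. strict_linear_order (the (R i)))"

definition margin :: "'a profile \<Rightarrow> 'a \<Rightarrow> 'a \<Rightarrow> int" where
  "margin R x y = int (card {i\<in>dom R. (x,y) \<in> pref R i})
                - int (card {i\<in>dom R. (y,x) \<in> pref R i})"

definition maj_weak :: "'a profile \<Rightarrow> 'a \<Rightarrow> 'a \<Rightarrow> bool" where
  "maj_weak R x y \<longleftrightarrow> margin R x y \<ge> 0"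

definition maj_strict :: "'a profile \<Rightarrow> 'a \<Rightarrow> 'a \<Rightarrow> bool" where
  "maj_strict R x y \<longleftrightarrow> maj_weak R x y \<and> \<not> maj_weak R y x"

definition dominant :: "'a profile \<Rightarrow> 'a set \<Rightarrow> bool" where
  "dominant R X \<longleftrightarrow> X \<noteq> {} \<and> (\<forall>x\<in>X. \<forall>y\<in>UNIV - X. maj_strict R x y)"

definition is_SCC :: "('a profile \<Rightarrow> 'a set) \<Rightarrow> bool" where
  "is_SCC f \<longleftrightarrow> (\<forall>R. valid_profile R \<longrightarrow> f R \<noteq> {})"

definition pairwise_scc :: "('a profile \<Rightarrow> 'a set) \<Rightarrow> bool" where
  "pairwise_scc f \<longleftrightarrow> (\<forall>R R'. valid_profile R \<and> valid_profile R' \<and> margin R = margin R'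
       \<longrightarrow> f R = f R')"

definition non_imposing :: "('a profile \<Rightarrow> 'a set) \<Rightarrow> bool" where
  "non_imposing f \<longleftrightarrow> (\<forall>x. \<exists>R. valid_profile R \<and> f R = {x})"

definition neutral :: "('a profile \<Rightarrow> 'a set) \<Rightarrow> bool" where
  "neutral f \<longleftrightarrow> (\<forall>R R' \<pi>. valid_profile R \<and> valid_profile R' \<and> dom R = dom R' \<and> bij \<pi> \<and>
      (\<forall>i\<in>dom R. \<forall>x y. (x,y) \<in> pref R i \<longleftrightarrow> (\<pi> x, \<pi> y) \<in> pref R' i)
      \<longrightarrow> f R' = \<pi> ` f R)"

definition copies :: "nat \<Rightarrow> 'a profile \<Rightarrow> 'a profile \<Rightarrow> bool" where
  "copies k R R' \<longleftrightarrow> (\<exists>h. (\<forall>j\<in>dom R'. h j \<in> dom R \<and> R' j = R (h j)) \<and>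
      (\<forall>i\<in>dom R. card {j\<in>dom R'. h j = i} = k))"

definition homogeneous :: "('a profile \<Rightarrow> 'a set) \<Rightarrow> bool" where
  "homogeneous f \<longleftrightarrow> (\<forall>R R' k. valid_profile R \<and> valid_profile R' \<and> k \<ge> 1 \<and> copies k R R'
      \<longrightarrow> f R' = f R)"

definition set_pref :: "'a rel \<Rightarrow> 'a set \<Rightarrow> 'a set \<Rightarrow> bool" where
  "set_pref r X Y \<longleftrightarrow> (\<forall>x\<in>X. \<forall>y\<in>Y. (x,y) \<in> r)"

definition fishburn :: "'a rel \<Rightarrow> 'a set \<Rightarrow> 'a set \<Rightarrow> bool" where
  "fishburn r X Y \<longleftrightarrow> X \<noteq> Y \<and> set_pref r (X - Y) Y \<and> set_pref r X (Y - X)"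

definition strategyproof :: "('a profile \<Rightarrow> 'a set) \<Rightarrow> bool" where
  "strategyproof f \<longleftrightarrow> \<not> (\<exists>R R' i. valid_profile R \<and> valid_profile R' \<and> dom R = dom R' \<and>
      i \<in> dom R \<and> (\<forall>j\<in>dom R. j \<noteq> i \<longrightarrow> R j = R' j) \<and>
      fishburn (pref R i) (f R') (f R))"

definition dominant_set_rule :: "('a profile \<Rightarrow> 'a set) \<Rightarrow> bool" where
  "dominant_set_rule f \<longleftrightarrow> (\<forall>R. valid_profile R \<longrightarrow> dominant R (f R))"

definition robust :: "('a profile \<Rightarrow> 'a set) \<Rightarrow> bool" where
  "robust f \<longleftrightarrow> (\<forall>R R'. valid_profile R \<and> valid_profile R' \<and> dominant R' (f R)
      \<longrightarrow> f R' \<subseteq> f R)"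

end

theory Submission
  imports Defs
begin

text \<open>
  A pairwise and homogeneous SCC is a function \<open>F\<close> of skew integer matrices, invariant under scaling, and
  strategyproofness controls how \<open>F\<close> reacts when \<open>x\<close> is strengthened by one unit against \<open>y\<close>: the
  choice set \<open>X\<close> stays, or \<open>x\<close> enters while \<open>y \<in> X\<close>, or \<open>y\<close> leaves while \<open>x\<close> stays, or (a case
  that is ruled out only at the very end) \<open>x\<close> leaves and \<open>y\<close> enters. Together with neutrality this
  shows that singletons are chosen exactly when they are Condorcet winners, and that a chosen set
  with more than one element never contains (nor is it dominated by) an alternative beating all
  its other elements.

  Call a matrix linked if only the set of all alternatives is dominant, and view its
  positive entries as a directed multigraph. A minimal linked multigraph with \<open>F G \<noteq> UNIV\<close> is
  bipartite, all edges leading from \<open>X = F G\<close> to its complement, since deleting any edge makes \<open>F\<close>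
  choose everything. Adding edges from a centre \<open>v \<in> X\<close> to other elements of \<open>X\<close> keeps the
  heads of \<open>G\<close> out of the choice set as long as deleting the corresponding edge of \<open>G\<close> leaves no
  minimal multigraph inside; in the end \<open>v\<close> beats all other chosen alternatives, a
  contradiction. An extremal choice of \<open>G\<close> makes this work unless \<open>G\<close> is a star with edges of
  weight one, which is excluded by symmetry. So linked matrices yield \<open>UNIV\<close>. A matrix of
  minimal weight at which \<open>F\<close> is not dominant would be linked, hence \<open>F\<close> always chooses a
  dominant set, and robustness follows by making the elements of the dominant set tie.
\<close>

section \<open>Skew-symmetric margin matrices and unit shifts\<close>

definition skew :: "('a \<Rightarrow> 'a \<Rightarrow> int) \<Rightarrow> bool" where
  "skew g \<longleftrightarrow> (\<forall>x y. g y x = - g x y)"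

definition shift :: "('a \<Rightarrow> 'a \<Rightarrow> int) \<Rightarrow> 'a set \<Rightarrow> 'a set \<Rightarrow> 'a \<Rightarrow> 'a \<Rightarrow> int" where
  "shift g U V = (\<lambda>a b. g a b + of_bool (a \<in> U \<and> b \<in> V) - of_bool (b \<in> U \<and> a \<in> V))"

definition dom_in :: "('a \<Rightarrow> 'a \<Rightarrow> int) \<Rightarrow> 'a set \<Rightarrow> bool" where
  "dom_in g X \<longleftrightarrow> X \<noteq> {} \<and> (\<forall>x\<in>X. \<forall>y\<in>-X. g x y > 0)"

definition weight :: "('a::finite \<Rightarrow> 'a \<Rightarrow> int) \<Rightarrow> nat" where
  "weight g = (\<Sum>x\<in>UNIV. \<Sum>y\<in>UNIV. nat \<bar>g x y\<bar>)"

lemma skewD: "skew g \<Longrightarrow> g y x = - g x y"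
  unfolding skew_def by blast

lemma skewI: "(\<And>x y. g y x = - g x y) \<Longrightarrow> skew g"
  unfolding skew_def by blast

lemma skew_diag: "skew g \<Longrightarrow> g x x = 0"
  using skewD[of g x x] by simp

lemma skew_shift [intro]:
  assumes "skew g" shows "skew (shift g U V)"
proof (rule skewI)
  fix x y
  show "shift g U V y x = - shift g U V x y"
    using skewD[OF assms, of x y] by (simp add: shift_def)
qed

lemma skew_zero [simp]: "skew (\<lambda>_ _. 0)"
  by (simp add: skew_def)

lemma skew_mult [intro]:
  assumes "skew g" shows "skew (\<lambda>x y. k * g x y)"
proof (rule skewI)
  fix x y
  show "k * g y x = - (k * g x y)"
    using skewD[OF assms, of x y] by simp
qed

lemma shift_empty [simp]: "shift g U {} = g"
  by (simp add: shift_def)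

lemma shift_insert: "s \<notin> S \<Longrightarrow> shift g {v} (insert s S) = shift (shift g {v} S) {v} {s}"
  by (auto simp: shift_def fun_eq_iff)

lemma shift_commute: "shift (shift g U V) U' V' = shift (shift g U' V') U V"
  by (auto simp: shift_def fun_eq_iff)

lemma shift_back: "x \<noteq> y \<Longrightarrow> shift (shift g {x} {y}) {y} {x} = g"
  by (auto simp: shift_def fun_eq_iff)

lemma sum_strict2:
  fixes p q :: "'a::finite \<Rightarrow> 'b::finite \<Rightarrow> nat"
  assumes "\<And>x y. p x y \<le> q x y" and "p x0 y0 < q x0 y0"
  shows "(\<Sum>x\<in>UNIV. \<Sum>y\<in>UNIV. p x y) < (\<Sum>x\<in>UNIV. \<Sum>y\<in>UNIV. q x y)"
proof -
  have 1: "sum (p x) UNIV \<le> sum (q x) UNIV" for x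
    using assms(1) by (rule sum_mono)
  have "\<exists>y\<in>UNIV. p x0 y < q x0 y" using assms(2) by blast
  then have 2: "sum (p x0) UNIV < sum (q x0) UNIV"
    by (intro sum_strict_mono_ex1[OF finite_UNIV]) (blast intro: assms(1))+
  then have "\<exists>x\<in>UNIV. sum (p x) UNIV < sum (q x) UNIV" by blast
  with 1 show ?thesis by (intro sum_strict_mono_ex1[OF finite_UNIV]) blast+
qed

lemma weight_lower:
  fixes g :: "'a::finite \<Rightarrow> 'a \<Rightarrow> int"
  assumes "skew g" "g a b > 0"
  shows "weight (shift g {b} {a}) < weight g"
  unfolding weight_def
proof (rule sum_strict2)
  have ab: "g b a = - g a b" "a \<noteq> b" using assms skew_diag[of g a] skewD[of g a b] by auto
  show "nat \<bar>shift g {b} {a} x y\<bar> \<le> nat \<bar>g x y\<bar>" for x y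
    using ab assms by (auto simp: shift_def)
  show "nat \<bar>shift g {b} {a} a b\<bar> < nat \<bar>g a b\<bar>"
    using ab assms by (auto simp: shift_def)
qed

text \<open>Moves from \<open>g\<close> to \<open>h\<close> by unit shifts, each intermediate entry staying between the two end points.\<close>

lemma step_induct:
  fixes g h :: "'a::finite \<Rightarrow> 'a \<Rightarrow> int"
  assumes "skew g" "skew h" "P g"
    and step: "\<And>k x y. \<lbrakk>skew k; P k; k x y < h x y; \<And>a b. g a b \<le> h a b \<Longrightarrow> g a b \<le> k a b \<and> k a b \<le> h a b\<rbrakk>
       \<Longrightarrow> P (shift k {x} {y})"
  shows "P h"
proof -
  define m where "m = (\<lambda>k :: 'a \<Rightarrow> 'a \<Rightarrow> int. weight (\<lambda>a b. h a b - k a b))"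
  define I where "I = (\<lambda>k :: 'a \<Rightarrow> 'a \<Rightarrow> int. skew k \<and> P k \<and> (\<forall>a b. g a b \<le> h a b \<longrightarrow> g a b \<le> k a b \<and> k a b \<le> h a b))"
  have "I k \<Longrightarrow> P h" for k
  proof (induction "m k" arbitrary: k rule: less_induct)
    case less
    note k = less.prems
    show ?case
    proof (cases "k = h")
      case False
      then obtain x y where "k x y \<noteq> h x y" by (auto simp: fun_eq_iff)
      then have "k x y < h x y \<or> k y x < h y x"
        using k assms(2) skewD[of k x y] skewD[of h x y] by (force simp: I_def)
      then obtain x y where xy: "k x y < h x y" by auto
      have sk: "skew k" using k by (simp add: I_def)
      have yx: "k y x = - k x y" "h y x = - h x y" using skewD[OF sk, of x y] skewD[OF assms(2), of x y] by auto
      have ne: "x \<noteq> y" using xy skew_diag[OF sk, of x] skew_diag[OF assms(2), of x] by auto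
      have "P (shift k {x} {y})" using step[of k x y] k xy by (auto simp: I_def)
      moreover have "g a b \<le> shift k {x} {y} a b \<and> shift k {x} {y} a b \<le> h a b" if gh: "g a b \<le> h a b" for a b
      proof -
        have 1: "g a b \<le> k a b" "k a b \<le> h a b" using k gh by (auto simp: I_def)
        \<comment> \<open>At the mirror position \<open>(y, x)\<close> skewness makes
          \<open>k\<close> larger than \<open>h\<close>, so an entry that has to rise from
          \<open>g\<close> to \<open>h\<close> is never the one that drops.\<close>
        have 2: "\<not> (a = y \<and> b = x)" using 1 xy yx by auto
        show ?thesis using 1 2 xy ne by (auto simp: shift_def)
      qed
      ultimately have I: "I (shift k {x} {y})" using sk by (auto simp: I_def)
      have eq: "(\<lambda>a b. h a b - shift k {x} {y} a b) = shift (\<lambda>a b. h a b - k a b) {y} {x}"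
        using ne by (intro ext) (auto simp: shift_def)
      have sd: "skew (\<lambda>a b. h a b - k a b)"
      proof (rule skewI)
        fix a b
        show "h b a - k b a = - (h a b - k a b)"
          using skewD[OF sk, of a b] skewD[OF assms(2), of a b] by simp
      qed
      have "m (shift k {x} {y}) < m k"
        unfolding m_def eq by (rule weight_lower[OF sd]) (use xy in simp)
      from less.hyps[OF this I] show ?thesis .
    qed (use k I_def in auto)
  qed
  moreover have "I g" using assms by (auto simp: I_def)
  ultimately show ?thesis by blast
qed

text \<open>The properties of an SCC carried over from profiles to margins. \<open>swap\<close> and
  \<open>lift\<close> are the traces of strategyproofness: a voter exchanges two adjacent
  alternatives, or moves the chosen set from the bottom to the top. The nonempty intersection in the
  last case of \<open>swap\<close> keeps chosen singletons stable.\<close>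

locale choice =
  fixes F :: "('a::finite \<Rightarrow> 'a \<Rightarrow> int) \<Rightarrow> 'a set"
  assumes nonempty: "skew g \<Longrightarrow> F g \<noteq> {}"
    and homog: "skew g \<Longrightarrow> k > 0 \<Longrightarrow> F (\<lambda>x y. int k * g x y) = F g"
    and neutr: "skew g \<Longrightarrow> bij p \<Longrightarrow> F (\<lambda>x y. g (p x) (p y)) = {x. p x \<in> F g}"
    and nonimp: "\<exists>g. skew g \<and> F g = {x}"
    and swap: "skew g \<Longrightarrow> x \<noteq> y \<Longrightarrow> F (shift g {x} {y}) = F g
        \<or> x \<notin> F g \<and> x \<in> F (shift g {x} {y}) \<and> y \<in> F g
        \<or> x \<in> F g \<and> x \<in> F (shift g {x} {y}) \<and> y \<in> F g \<and> y \<notin> F (shift g {x} {y})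
        \<or> x \<in> F g \<and> x \<notin> F (shift g {x} {y}) \<and> y \<notin> F g \<and> y \<in> F (shift g {x} {y})
            \<and> F g \<inter> F (shift g {x} {y}) \<noteq> {}"
    and lift: "skew g \<Longrightarrow> F (shift g (F g) (- F g)) = F g"
begin

text \<open>The transposition of \<open>x\<close> and \<open>y\<close> is an automorphism of
  \<open>g\<close>, so neutrality cannot separate them.\<close>

lemma twins:
  assumes "skew g" "g x y = 0" "\<And>u. u \<noteq> x \<Longrightarrow> u \<noteq> y \<Longrightarrow> g u x = g u y"
  shows "x \<in> F g \<longleftrightarrow> y \<in> F g"
proof -
  define p where "p = (\<lambda>u. if u = x then y else if u = y then x else u)"
  have "p \<circ> p = id" by (auto simp: p_def)
  then have "bij p" using o_bij by blast
  have 1: "g x u = g y u" if "u \<noteq> x" "u \<noteq> y" for u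
    using assms(3)[OF that] skewD[OF assms(1), of x u] skewD[OF assms(1), of y u] by simp
  have 2: "g y x = 0" using assms(2) skewD[OF assms(1), of y x] by simp
  have 3: "g x x = 0" "g y y = 0" by (rule skew_diag[OF assms(1)])+
  have "(\<lambda>u w. g (p u) (p w)) = g"
  proof (intro ext)
    fix u w
    show "g (p u) (p w) = g u w"
      unfolding p_def
      by (cases "u = x"; cases "u = y"; cases "w = x"; cases "w = y";
          (simp_all only: if_True if_False simp_thms)?; (simp_all add: 1 2 3 assms(2,3))?)
  qed
  then have "F g = {u. p u \<in> F g}" using neutr[OF assms(1) \<open>bij p\<close>] by simp
  then have "x \<in> F g \<longleftrightarrow> p x \<in> F g" by blast
  then show ?thesis by (simp add: p_def)
qed

lemma F_zero: "F (\<lambda>_ _. 0) = UNIV"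
proof -
  have "x \<in> F (\<lambda>_ _. 0) \<longleftrightarrow> y \<in> F (\<lambda>_ _. 0)" for x y by (rule twins) auto
  then show ?thesis using nonempty[of "\<lambda>_ _. 0"] by auto
qed

section \<open>Singleton choices and Condorcet winners\<close>

lemma raise_unchosen:
  assumes "skew g" "x \<noteq> y" "x \<notin> F g" "y \<notin> F g"
  shows "F (shift g {x} {y}) = F g"
  using swap[OF assms(1,2)] assms(3,4) by blast


text \<open>A monotone path of unit shifts from \<open>g\<close> to \<open>h\<close> leaves the rows
  and columns of chosen alternatives alone, and raising one unchosen alternative against another has
  no effect.\<close>

lemma change_unchosen:
  assumes "skew g" "skew h" and eq: "\<And>a b. a \<in> F g \<Longrightarrow> g a b = h a b"
  shows "F h = F g"
proof -
  have sym: "g a b = h a b" if "b \<in> F g" for a b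
    using eq[OF that, of a] skewD[OF assms(1), of b a] skewD[OF assms(2), of b a] by simp
  show ?thesis
  proof (rule step_induct[of g h "\<lambda>k. F k = F g", OF assms(1,2) refl])
    fix k x y
    assume k: "skew k" "F k = F g" "k x y < h x y"
      "\<And>a b. g a b \<le> h a b \<Longrightarrow> g a b \<le> k a b \<and> k a b \<le> h a b"
    have "k a b = h a b" if "a \<in> F g \<or> b \<in> F g" for a b
      using k(4)[of a b] eq[of a b] sym[of b a] that by auto
    then have "x \<notin> F k" "y \<notin> F k" using k(2,3) by auto
    moreover have "x \<noteq> y" using k(3) skew_diag[OF k(1), of x] skew_diag[OF assms(2), of x] by auto
    ultimately show "F (shift k {x} {y}) = F g" using raise_unchosen k by auto
  qed
qed

text \<open>As row \<open>x\<close> never drops on the path, \<open>x\<close> is never the weakened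
  alternative. Of the changes in \<open>swap\<close> only the last remains, and there the common
  element of both sets would have to be \<open>x\<close>, which leaves.\<close>

lemma singleton_raise:
  assumes "skew g" "skew h" "F g = {x}" and le: "\<And>w. g x w \<le> h x w"
  shows "F h = {x}"
proof (rule step_induct[of g h "\<lambda>k. F k = {x}", OF assms(1-3)])
  fix k a b
  assume k: "skew k" "F k = {x}" "k a b < h a b"
      "\<And>a b. g a b \<le> h a b \<Longrightarrow> g a b \<le> k a b \<and> k a b \<le> h a b"
  have ne: "a \<noteq> b" using k(3) skew_diag[OF k(1), of a] skew_diag[OF assms(2), of a] by auto
  have "b \<noteq> x"
  proof
    assume "b = x"
    then have "k x a > h x a" using k(3) skewD[OF k(1), of x a] skewD[OF assms(2), of x a] by simp
    with k(4)[OF le, of a] show False by simp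
  qed
  then show "F (shift k {a} {b}) = {x}" using swap[OF k(1) ne] k(2) by auto
qed

text \<open>If \<open>x\<close> fails to beat \<open>y\<close>, row \<open>x\<close> can be raised
  until \<open>x\<close> and \<open>y\<close> tie and have equal large margins against all others.
  The choice is still \<open>{x}\<close>, although \<open>x\<close> and \<open>y\<close> are now
  twins.\<close>

lemma singleton_dom:
  assumes "skew g" "F g = {x}"
  shows "dom_in g {x}"
proof (rule ccontr)
  assume "\<not> dom_in g {x}"
  then obtain y where y: "y \<noteq> x" "g x y \<le> 0" by (auto simp: dom_in_def not_less)
  define M where "M = (\<Sum>w\<in>UNIV. \<bar>g x w\<bar>)"
  define h where "h = (\<lambda>a b. if (a = x \<or> a = y) \<and> b \<noteq> x \<and> b \<noteq> y then M
      else if (b = x \<or> b = y) \<and> a \<noteq> x \<and> a \<noteq> y then - M else 0)"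
  have M: "g x w \<le> M" for w
  proof -
    have "\<bar>g x w\<bar> \<le> M" unfolding M_def by (rule member_le_sum) auto
    then show ?thesis by simp
  qed
  have sk: "skew h" by (auto simp: skew_def h_def)
  have "g x w \<le> h x w" for w
    using M[of w] y skew_diag[OF assms(1), of x] by (auto simp: h_def)
  then have "F h = {x}" using singleton_raise assms sk by blast
  moreover have "x \<in> F h \<longleftrightarrow> y \<in> F h" using sk by (rule twins) (use y in \<open>auto simp: h_def\<close>)
  ultimately show False using y by auto
qed

text \<open>Non-imposition provides some \<open>h\<close> with choice \<open>{x}\<close>. A large
  multiple of \<open>g\<close> is at least \<open>h\<close> in row \<open>x\<close>, so it also
  yields \<open>{x}\<close>, and homogeneity removes the factor.\<close>

lemma Condorcet:
  assumes "skew g" "dom_in g {x}"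
  shows "F g = {x}"
proof -
  obtain h where h: "skew h" "F h = {x}" using nonimp by blast
  define M where "M = (\<Sum>w\<in>UNIV. \<bar>h x w\<bar>)"
  have M: "h x w \<le> M" for w
  proof -
    have "\<bar>h x w\<bar> \<le> M" unfolding M_def by (rule member_le_sum) auto
    then show ?thesis by simp
  qed
  have M0: "M \<ge> 0" unfolding M_def by (auto intro: sum_nonneg)
  define k where "k = nat M + 1"
  have k: "int k = M + 1" "k > 0" using M0 by (auto simp: k_def)
  have "h x w \<le> int k * g x w" for w
  proof (cases "w = x")
    case False
    then have "g x w > 0" using assms by (simp add: dom_in_def)
    then have "g x w \<ge> 1" by simp
    then have "int k * 1 \<le> int k * g x w" by (intro mult_left_mono) auto
    with M[of w] k(1) show ?thesis by linarith
  qed (simp add: skew_diag[OF h(1)] skew_diag[OF assms(1)])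
  then have "F (\<lambda>a b. int k * g a b) = {x}"
    using singleton_raise[OF h(1) _ h(2)] assms(1) by blast
  then show ?thesis using homog[OF assms(1) k(2)] by simp
qed

lemma lift_many:
  assumes "skew g" "F g = X"
  shows "F (\<lambda>a b. g a b + int k * (of_bool (a \<in> X \<and> b \<notin> X) - of_bool (b \<in> X \<and> a \<notin> X))) = X"
    (is "F (?g k) = X")
proof (induction k)
  case 0
  then show ?case using assms by simp
next
  case (Suc k)
  have sk: "skew (?g k)" 
    by (rule skewI, subst skewD[OF assms(1)]) auto
  have "?g (Suc k) = shift (?g k) X (- X)" by (auto simp: shift_def fun_eq_iff algebra_simps)
  then show ?case using lift[OF sk] Suc by simp
qed

text \<open>An unchosen \<open>v\<close> could be made a Condorcet winner by altering only entries
  between unchosen alternatives, which does not affect the choice. A chosen \<open>v\<close> becomes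
  one when the chosen set is lifted often enough above its complement.\<close>

lemma beats_chosen:
  assumes g: "skew g" and v: "\<And>x. x \<in> F g \<Longrightarrow> x \<noteq> v \<Longrightarrow> g v x > 0"
  shows "F g = {v}"
proof (cases "v \<in> F g")
  case False
  define h where "h = (\<lambda>a b. if a = v \<and> b \<notin> F g \<and> b \<noteq> v then 1 else if b = v \<and> a \<notin> F g \<and> a \<noteq> v then - 1 else g a b)"
  have sk: "skew h" 
  proof (rule skewI)
    fix a b
    show "h b a = - h a b" using skewD[OF g, of a b] False by (auto simp: h_def)
  qed
  have "F h = F g" by (rule change_unchosen[OF g sk]) (use False in \<open>auto simp: h_def\<close>)
  moreover have "F h = {v}" by (rule Condorcet[OF sk]) (use v in \<open>auto simp: dom_in_def h_def\<close>)
  ultimately show ?thesis using False by simp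
next
  case True
  define X where "X = F g"
  define M where "M = (\<Sum>w\<in>UNIV. \<bar>g v w\<bar>)"
  have M: "- g v w \<le> M" for w
  proof -
    have "\<bar>g v w\<bar> \<le> M" unfolding M_def by (rule member_le_sum) auto
    then show ?thesis by simp
  qed
  have M0: "M \<ge> 0" unfolding M_def by (auto intro: sum_nonneg)
  define k where "k = nat M + 1"
  have k: "int k = M + 1" using M0 by (auto simp: k_def)
  let ?h = "\<lambda>a b. g a b + int k * (of_bool (a \<in> X \<and> b \<notin> X) - of_bool (b \<in> X \<and> a \<notin> X))"
  have sk: "skew ?h" 
    by (rule skewI, subst skewD[OF g]) auto
  have "?h v y > 0" if "y \<noteq> v" for y
    using M[of y] k v[of y] that True by (auto simp: X_def)
  then have "F ?h = {v}" by (intro Condorcet[OF sk]) (auto simp: dom_in_def)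
  then show ?thesis using lift_many[OF g, of X k] by (simp add: X_def)
qed

end

section \<open>Minimal linked matrices without full choice\<close>

definition linked :: "('a \<Rightarrow> 'a \<Rightarrow> int) \<Rightarrow> bool" where
  "linked g \<longleftrightarrow> (\<forall>Y. dom_in g Y \<longrightarrow> Y = UNIV)"

text \<open>Inclusion of the multigraphs formed by the positive entries.\<close>

definition below :: "('a \<Rightarrow> 'a \<Rightarrow> int) \<Rightarrow> ('a \<Rightarrow> 'a \<Rightarrow> int) \<Rightarrow> bool" where
  "below k g \<longleftrightarrow> (\<forall>x y. k x y \<le> max 0 (g x y))"

lemma below_refl: "below g g"
  by (simp add: below_def)

lemma below_trans: "below k g \<Longrightarrow> below g h \<Longrightarrow> below k h"
proof -
  have "a \<le> max 0 b \<Longrightarrow> b \<le> max 0 c \<Longrightarrow> a \<le> max 0 c" for a b c :: int by auto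
  then show "below k g \<Longrightarrow> below g h \<Longrightarrow> below k h" unfolding below_def by blast
qed

lemma belowD: "below k g \<Longrightarrow> k x y \<le> max 0 (g x y)"
  by (simp add: below_def)

lemma below_pos: "below k g \<Longrightarrow> k x y > 0 \<Longrightarrow> k x y \<le> g x y"
  using belowD[of k g x y] by auto

lemma linked_below:
  assumes "linked g" "below k g"
  shows "linked k"
proof -
  have "dom_in g Y" if "dom_in k Y" for Y
    using that below_pos[OF assms(2)] unfolding dom_in_def by (meson order_less_le_trans)
  then show ?thesis using assms(1) by (auto simp: linked_def)
qed

text \<open>A proper dominant set cannot contain \<open>y\<close>, which beats nothing, hence not
  \<open>v\<close>, which fails to beat \<open>y\<close>; but then its members would beat
  \<open>v\<close>. This certifies linkedness after edges are added at a centre.\<close>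

lemma linked_witness:
  assumes "v \<noteq> y" "\<And>u. h u v \<le> 0" "\<not> h v y > 0" "\<And>u. h y u \<le> 0"
  shows "linked h"
  unfolding linked_def
proof (intro allI impI, rule ccontr)
  fix Y assume d: "dom_in h Y" and "Y \<noteq> UNIV"
  then obtain w where w: "w \<notin> Y" by blast
  have Y: "Y \<noteq> {}" "\<And>a b. a \<in> Y \<Longrightarrow> b \<notin> Y \<Longrightarrow> h a b > 0" using d by (auto simp: dom_in_def)
  have "y \<notin> Y" using Y(2)[OF _ w, of y] assms(4)[of w] by auto
  then have "v \<notin> Y" using Y(2)[of v y] assms(3) by auto
  then show False using Y assms(2) by (metis all_not_in_conv not_less)
qed

lemma shift_single:
  "x \<noteq> y \<Longrightarrow> shift g {x} {y} a b =
     (if a = x \<and> b = y then g a b + 1 else if a = y \<and> b = x then g a b - 1 else g a b)"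
  by (auto simp: shift_def)

lemma lower_below:
  assumes "skew g" "g a b > 0"
  shows "below (shift g {b} {a}) g"
proof -
  have "a \<noteq> b" using assms skew_diag[of g a] by auto
  moreover have "g b a < 0" using assms skewD[of g a b] by simp
  ultimately show ?thesis using assms by (auto simp: below_def shift_single)
qed

lemma below_weight:
  assumes "skew k" "skew g" "below k g"
  shows "weight k \<le> weight g"
proof -
  have 1: "\<bar>k x y\<bar> \<le> \<bar>g x y\<bar>" for x y
    using belowD[OF assms(3), of x y] belowD[OF assms(3), of y x]
      skewD[OF assms(1), of x y] skewD[OF assms(2), of x y] by auto
  show ?thesis unfolding weight_def by (intro sum_mono nat_mono 1)
qed

lemma below_weight_eq:
  assumes "skew k" "skew g" "below k g" "k \<noteq> g"
  shows "\<exists>a b. g a b > 0 \<and> k a b < g a b \<and> below k (shift g {b} {a})"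
proof -
  obtain x y where "k x y \<noteq> g x y" using assms(4) by (auto simp: fun_eq_iff)
  then have "k x y < g x y \<or> k y x < g y x"
    using skewD[OF assms(1), of x y] skewD[OF assms(2), of x y] by auto
  then obtain a b where ab: "k a b < g a b" by blast
  have g: "g b a = - g a b" "k b a = - k a b"
    using skewD[OF assms(2), of a b] skewD[OF assms(1), of a b] by auto
  have ne: "a \<noteq> b" using ab skew_diag[OF assms(1)] skew_diag[OF assms(2)] by auto
  \<comment> \<open>Otherwise \<open>k b a > g b a\<close> with \<open>g b a \<ge> 0\<close>,
    against \<open>below\<close>.\<close>
  have pos: "g a b > 0" using ab g belowD[OF assms(3), of b a] by auto
  have "below k (shift g {b} {a})"
    unfolding below_def
  proof (intro allI)
    fix x y
    show "k x y \<le> max 0 (shift g {b} {a} x y)"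
      using belowD[OF assms(3), of x y] ab pos g ne by (auto simp: shift_single)
  qed
  with ab pos show ?thesis by blast
qed

context choice
begin

text \<open>Linkedness passes to sub-multigraphs, so the minimality clause only has to speak of the
  choice set.\<close>

definition minimal_bad :: "('a \<Rightarrow> 'a \<Rightarrow> int) \<Rightarrow> bool" where
  "minimal_bad K \<longleftrightarrow> skew K \<and> linked K \<and> F K \<noteq> UNIV \<and>
     (\<forall>K'. skew K' \<and> below K' K \<and> K' \<noteq> K \<longrightarrow> F K' = UNIV)"

lemma minimal_bad_exists:
  assumes "skew H" "linked H" "F H \<noteq> UNIV"
  shows "\<exists>K. minimal_bad K \<and> below K H"
  using assms
proof (induction "weight H" arbitrary: H rule: less_induct)
  case less
  show ?case
  proof (cases "minimal_bad H")
    case True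
    then show ?thesis using below_refl by blast
  next
    case False
    then obtain K where K: "skew K" "below K H" "K \<noteq> H" "F K \<noteq> UNIV"
      using less.prems by (auto simp: minimal_bad_def)
    obtain a b where ab: "H a b > 0" "below K (shift H {b} {a})"
      using below_weight_eq[OF K(1) less.prems(1) K(2,3)] by blast
    have "weight K \<le> weight (shift H {b} {a})"
      using below_weight[OF K(1) _ ab(2)] less.prems(1) by blast
    also have "\<dots> < weight H" using weight_lower[of H a b] less.prems(1) ab(1) by blast
    finally have "\<exists>K'. minimal_bad K' \<and> below K' K"
      using less.hyps[of K] K linked_below[OF less.prems(2) K(2)] by blast
    then show ?thesis using below_trans K(2) by blast
  qed
qed

lemma raise_all:
  assumes "skew g" "x \<noteq> y" "F g = UNIV"
  shows "F (shift g {x} {y}) = UNIV \<or> x \<in> F (shift g {x} {y}) \<and> y \<notin> F (shift g {x} {y})"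
  using swap[OF assms(1,2)] assms(3) by auto

lemma raise_chosen:
  assumes "skew g" "x \<noteq> y" "x \<in> F g" "y \<in> F g"
  shows "F (shift g {x} {y}) = F g \<or> x \<in> F (shift g {x} {y}) \<and> y \<notin> F (shift g {x} {y})"
  using swap[OF assms(1,2)] assms(3,4) by auto

lemma pos_ne: "skew g \<Longrightarrow> g x y > 0 \<Longrightarrow> x \<noteq> y"
  using skew_diag[of g x] by auto

text \<open>With one unit of the edge from \<open>u\<close> to \<open>z\<close> deleted the choice
  is full, since otherwise a minimal bad multigraph would lie inside. Restoring the unit keeps the
  full choice or expels \<open>z\<close> while keeping \<open>u\<close>.\<close>

lemma edge_removal:
  assumes "skew H" "linked H" "H u z > 0"
    and "\<And>K. minimal_bad K \<Longrightarrow> below K (shift H {z} {u}) \<Longrightarrow> False"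
  shows "F H = UNIV \<or> u \<in> F H \<and> z \<notin> F H"
proof -
  have ne: "u \<noteq> z" by (rule pos_ne[OF assms(1,3)])
  let ?L = "shift H {z} {u}"
  have sk: "skew ?L" by (rule skew_shift[OF assms(1)])
  have "linked ?L" by (rule linked_below[OF assms(2) lower_below[OF assms(1,3)]])
  then have "F ?L = UNIV" using minimal_bad_exists[OF sk] assms(4) by blast
  moreover have "shift ?L {u} {z} = H" using ne shift_back[of z u H] by simp
  ultimately show ?thesis using raise_all[OF sk ne] by simp
qed

lemma minimal_badD:
  assumes "minimal_bad K"
  shows "skew K" "linked K" "F K \<noteq> UNIV"
    and "\<And>K'. skew K' \<Longrightarrow> below K' K \<Longrightarrow> K' \<noteq> K \<Longrightarrow> F K' = UNIV"
  using assms by (auto simp: minimal_bad_def)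

lemma minimal_bad_not_below_lower:
  assumes "minimal_bad K" "minimal_bad G" "G a b > 0" "below K (shift G {b} {a})"
  shows False
proof -
  have sk: "skew G" using assms(2) by (rule minimal_badD(1))
  have "below K G" by (rule below_trans[OF assms(4) lower_below[OF sk assms(3)]])
  moreover have "K \<noteq> G"
  proof
    assume "K = G"
    then have "G a b \<le> max 0 (shift G {b} {a} a b)" using belowD[OF assms(4)] by blast
    moreover have "a \<noteq> b" by (rule pos_ne[OF sk assms(3)])
    ultimately show False using assms(3) by (simp add: shift_single)
  qed
  ultimately show False using minimal_badD(4)[OF assms(2)] minimal_badD[OF assms(1)] by blast
qed

text \<open>Once an edge of \<open>K\<close> is deleted, nothing minimal bad is left inside, so
  \<open>edge_removal\<close> applies to every edge. This makes \<open>K\<close> bipartite.\<close>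

lemma minimal_bad_edge:
  assumes "minimal_bad K" "K u z > 0"
  shows "u \<in> F K" "z \<notin> F K"
proof -
  have "F K = UNIV \<or> u \<in> F K \<and> z \<notin> F K"
    by (rule edge_removal[OF minimal_badD(1,2)[OF assms(1)] assms(2)]) (rule minimal_bad_not_below_lower[OF _ assms])
  then show "u \<in> F K" "z \<notin> F K" using minimal_badD(3)[OF assms(1)] by auto
qed

lemma minimal_bad_no_in: "minimal_bad K \<Longrightarrow> x \<in> F K \<Longrightarrow> K u x \<le> 0"
  using minimal_bad_edge(2)[of K u x] by (cases "K u x > 0") simp_all

lemma minimal_bad_no_out: "minimal_bad K \<Longrightarrow> z \<notin> F K \<Longrightarrow> K z u \<le> 0"
  using minimal_bad_edge(1)[of K z u] by (cases "K z u > 0") simp_all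

lemma minimal_bad_inside: "minimal_bad K \<Longrightarrow> x \<in> F K \<Longrightarrow> y \<in> F K \<Longrightarrow> K x y = 0"
  using minimal_bad_no_in[of K x y] minimal_bad_no_in[of K y x] skewD[of K x y] minimal_badD(1)[of K] by simp

text \<open>If \<open>x\<close> were an isolated unchosen alternative, it could be given the same outgoing edges as some
  tail \<open>c\<close> without any change of the choice set; then \<open>x\<close> and \<open>c\<close> are interchangeable, but only
  \<open>c\<close> is chosen.\<close>

lemma minimal_bad_head:
  assumes "minimal_bad K" "x \<notin> F K"
  shows "\<exists>u. K u x > 0"
proof (rule ccontr)
  assume no: "\<not> ?thesis"
  have sk: "skew K" using assms(1) by (rule minimal_badD(1))
  have x0: "K x w = 0" "K w x = 0" for w
  proof -
    have "\<not> K w x > 0" using no by blast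
    then show "K x w = 0" "K w x = 0" using minimal_bad_no_out[OF assms, of w] skewD[OF sk, of x w] by simp_all
  qed
  have "\<exists>c z. K c z > 0"
  proof (rule ccontr)
    assume "\<nexists>c z. K c z > 0"
    then have "K a b = 0" for a b
      using skewD[OF sk, of a b] spec[OF spec[OF \<open>\<nexists>c z. K c z > 0\<close>[unfolded not_ex]], of a b]
        spec[OF spec[OF \<open>\<nexists>c z. K c z > 0\<close>[unfolded not_ex]], of b a] by simp
    then have "K = (\<lambda>_ _. 0)" by (intro ext)
    then show False using F_zero minimal_badD(3)[OF assms(1)] by simp
  qed
  then obtain c z where cz: "K c z > 0" by blast
  have c: "c \<in> F K" using assms(1) cz by (rule minimal_bad_edge(1))
  then have cx: "c \<noteq> x" using assms by auto
  define h where "h = (\<lambda>a b. if a = x then if b = x then 0 else K c b else if b = x then K a c else K a b)"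
  have sh: "skew h"
  proof (rule skewI)
    fix a b show "h b a = - h a b"
      using skewD[OF sk, of a b] skewD[OF sk, of a c] skewD[OF sk, of c b] by (simp add: h_def)
  qed
  have "F h = F K"
  proof (rule change_unchosen[OF sk sh])
    fix a b assume "a \<in> F K"
    then show "K a b = h a b" using assms(2) x0 minimal_bad_inside[OF assms(1), of a c] c by (auto simp: h_def)
  qed
  moreover have "c \<in> F h \<longleftrightarrow> x \<in> F h"
    by (rule twins[OF sh]) (use cx skew_diag[OF sk] in \<open>auto simp: h_def\<close>)
  ultimately show False using c assms(2) by simp
qed

section \<open>Adding edges from a centre\<close>

lemma beats_chosen_contra:
  assumes "skew g" "\<And>x. x \<in> F g \<Longrightarrow> x \<noteq> v \<Longrightarrow> g v x > 0" "y \<noteq> v" "g v y \<le> 0"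
  shows False
proof -
  have "F g = {v}" using assms(1,2) by (rule beats_chosen)
  then have "dom_in g {v}" using singleton_dom assms(1) by blast
  then have "g v y > 0" using assms(3) by (simp add: dom_in_def)
  then show False using assms(4) by simp
qed

text \<open>Take a largest set of new edges from \<open>v\<close> for which \<open>v\<close> stays
  chosen and \<open>B\<close> unchosen. A chosen alternative not beaten by \<open>v\<close> could be
  added: the raise changes nothing or expels it, so the choice is not full and \<open>main\<close>
  protects \<open>B\<close>. Hence \<open>v\<close> beats all other chosen alternatives, but not the
  elements of \<open>B\<close>.\<close>

lemma center:
  assumes G: "skew G" "v \<in> F G" "v \<notin> S" and pos: "\<And>s. s \<in> S \<Longrightarrow> G v s \<ge> 0"
    and B: "B = {b. b \<noteq> v \<and> b \<notin> S \<and> G v b \<le> 0}" "B \<noteq> {}" "F G \<inter> B = {}"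
    and main: "\<And>S'. S' \<subseteq> S \<Longrightarrow> F (shift G {v} S') = UNIV \<or> F (shift G {v} S') \<inter> B = {}"
  shows False
proof -
  define Q where "Q = (\<lambda>S'. S' \<subseteq> S \<and> v \<in> F (shift G {v} S') \<and> F (shift G {v} S') \<inter> B = {})"
  have "Q {}" using assms by (auto simp: Q_def)
  moreover have "\<forall>S'. Q S' \<longrightarrow> card S' < Suc (card S)"
    by (auto simp: Q_def less_Suc_eq_le intro: card_mono)
  ultimately obtain S' where Q: "Q S'" and max: "\<And>T. Q T \<Longrightarrow> card T \<le> card S'"
    using ex_has_greatest_nat[of Q "{}" card "Suc (card S)"] by blast
  let ?h = "shift G {v} S'"
  have sk: "skew ?h" using G(1) by blast
  have val: "?h v x = G v x + (if x \<in> S' then 1 else 0)" for x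
    using G(3) Q by (auto simp: shift_def Q_def)
  obtain y where y: "y \<in> B" using B(2) by blast
  show False
  proof (rule beats_chosen_contra[OF sk])
    show "y \<noteq> v" "?h v y \<le> 0" using y B(1) val Q by (auto simp: Q_def)
  next
    fix s assume s: "s \<in> F ?h" "s \<noteq> v"
    show "?h v s > 0"
    proof (rule ccontr)
      assume not: "\<not> ?h v s > 0"
      have sB: "s \<notin> B" using s Q by (auto simp: Q_def)
      then have sS: "s \<in> S" "s \<notin> S'" using not val[of s] s B(1) pos[of s] by (auto split: if_splits)
      have eq: "shift G {v} (insert s S') = shift ?h {v} {s}" using sS(2) by (rule shift_insert)
      have "F (shift ?h {v} {s}) = F ?h \<or> v \<in> F (shift ?h {v} {s}) \<and> s \<notin> F (shift ?h {v} {s})"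
        by (rule raise_chosen[OF sk]) (use s Q Q_def in auto)
      then have "Q (insert s S')"
        using main[of "insert s S'"] Q sS(1) unfolding Q_def eq by auto
      then have "card (insert s S') \<le> card S'" by (rule max)
      then show False using sS(2) by (simp add: card_insert_if)
    qed
  qed
qed

end

section \<open>Pendant alternatives\<close>

text \<open>In the multigraph: the vertices whose only incoming edge is a single one from
  \<open>c\<close>.\<close>

definition pendants :: "('a \<Rightarrow> 'a \<Rightarrow> int) \<Rightarrow> 'a \<Rightarrow> 'a set" where
  "pendants K c = {z. K c z = 1 \<and> (\<forall>u. u \<noteq> c \<longrightarrow> K u z \<le> 0)}"

definition nonpendant_edge :: "('a \<Rightarrow> 'a \<Rightarrow> int) \<Rightarrow> 'a \<Rightarrow> 'a \<Rightarrow> 'a \<Rightarrow> nat" where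
  "nonpendant_edge K c u z = (if z \<in> pendants K c then 0 else nat (K u z))"

definition nonpendant :: "('a::finite \<Rightarrow> 'a \<Rightarrow> int) \<Rightarrow> 'a \<Rightarrow> nat" where
  "nonpendant K c = (\<Sum>u\<in>UNIV. \<Sum>z\<in>UNIV. nonpendant_edge K c u z)"

lemma pendI: "K c z = 1 \<Longrightarrow> (\<And>u. u \<noteq> c \<Longrightarrow> K u z \<le> 0) \<Longrightarrow> z \<in> pendants K c"
  by (simp add: pendants_def)

lemma pend_lost:
  assumes "z \<in> pendants G c" "z \<notin> pendants K c" "\<And>u. K u z \<le> max 0 (G u z)"
  shows "K u z \<le> 0"
proof -
  have le: "K w z \<le> 0" if "w \<noteq> c" for w
    using assms(1) assms(3)[of w] that by (auto simp: pendants_def)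
  have "K c z \<noteq> 1" using assms(2) le pendI[of K c z] by blast
  moreover have "K c z \<le> 1" using assms(1) assms(3)[of c] by (auto simp: pendants_def)
  ultimately have "K c z \<le> 0" by linarith
  then show ?thesis using le[of u] by (cases "u = c") auto
qed

lemma nonpendant_edge_zero: "K u z \<le> 0 \<Longrightarrow> nonpendant_edge K c u z = 0"
  by (simp add: nonpendant_edge_def)

lemma nonpendant_edge_le:
  assumes "K x y \<le> max 0 (G x y)" "K x y > 0 \<Longrightarrow> y \<notin> pendants G c"
  shows "nonpendant_edge K c' x y \<le> nonpendant_edge G c x y"
  using assms by (cases "K x y > 0") (auto simp: nonpendant_edge_def)

lemma shift_le: "y \<notin> S \<Longrightarrow> shift G {v} S x y \<le> G x y"
  by (auto simp: shift_def)

lemma shift_row: "y \<noteq> v \<Longrightarrow> x \<noteq> v \<Longrightarrow> shift G {v} S x y = G x y"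
  by (auto simp: shift_def)

lemma shift_out: "v \<notin> S \<Longrightarrow> shift G {v} S v y = G v y + (if y \<in> S then 1 else 0)"
  by (auto simp: shift_def)

lemma shift_in: "x \<noteq> v \<Longrightarrow> shift G {v} S x y \<le> G x y"
  by (auto simp: shift_def)

context choice
begin

lemma minimal_bad_below_eq:
  assumes "minimal_bad K" "minimal_bad G" "below K G" shows "K = G"
  using minimal_badD(4)[OF assms(2) minimal_badD(1)[OF assms(1)] assms(3)] minimal_badD(3)[OF assms(1)] by blast

lemma edge_removal':
  assumes "skew H" "linked H" "H u z > 0"
    and "\<And>K. minimal_bad K \<Longrightarrow> below K H \<Longrightarrow> K u z < H u z \<Longrightarrow> False"
  shows "F H = UNIV \<or> u \<in> F H \<and> z \<notin> F H"
proof (rule edge_removal[OF assms(1-3)])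
  fix K assume K: "minimal_bad K" "below K (shift H {z} {u})"
  have "u \<noteq> z" by (rule pos_ne[OF assms(1,3)])
  then have "K u z < H u z" using belowD[OF K(2), of u z] assms(3) by (simp add: shift_single)
  then show False using assms(4) K(1) below_trans[OF K(2) lower_below[OF assms(1,3)]] by blast
qed

text \<open>No edge of \<open>G\<close> enters the chosen elements of \<open>S\<close>, so their
  columns in \<open>K\<close> hold at most the single new edge from \<open>v\<close>.\<close>

lemma star_col:
  assumes "minimal_bad G" "v \<in> F G" "S \<subseteq> F G" "v \<notin> S" "below K (shift G {v} S)"
  shows "s \<in> S \<Longrightarrow> K v s \<le> 1" and "s \<in> S \<Longrightarrow> x \<noteq> v \<Longrightarrow> K x s \<le> 0"
    and "y \<notin> S \<Longrightarrow> K x y \<le> max 0 (G x y)"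
proof -
  show "K v s \<le> 1" if "s \<in> S"
    using belowD[OF assms(5), of v s] shift_out[OF assms(4), of G s] minimal_bad_inside[OF assms(1,2), of s] that assms(3)
    by auto
  show "K x s \<le> 0" if "s \<in> S" "x \<noteq> v"
    using belowD[OF assms(5), of x s] shift_in[OF that(2), of G S s] minimal_bad_no_in[OF assms(1), of s x] that assms(3)
    by auto
  show "K x y \<le> max 0 (G x y)" if "y \<notin> S"
    using belowD[OF assms(5), of x y] shift_le[OF that, of G v x] by auto
qed

text \<open>A new edge in \<open>K\<close> makes its head a pendant of \<open>v\<close>. Without new
  edges \<open>K\<close> would lie inside \<open>G\<close> and equal it by minimality, yet it lacks
  part of the edge from \<open>u\<close> to \<open>b\<close>.\<close>

lemma star_pend:
  assumes G: "minimal_bad G" "v \<in> F G" "S \<subseteq> F G" "v \<notin> S" and K: "minimal_bad K" "below K (shift G {v} S)" "K u b < G u b"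
  shows "\<exists>s\<in>S. s \<in> pendants K v"
proof (rule ccontr)
  assume no: "\<not> ?thesis"
  note col = star_col[OF G K(2)]
  have "K x y \<le> max 0 (G x y)" for x y
  proof (cases "y \<in> S")
    case True
    then have "K v y \<noteq> 1" using no col(2)[of y] pendI[of K v y] by blast
    then show ?thesis using col(1)[OF True] col(2)[OF True, of x] by (cases "x = v") auto
  qed (rule col(3))
  then have "below K G" by (simp add: below_def)
  then show False using minimal_bad_below_eq[OF K(1) G(1)] K(3) by simp
qed

text \<open>New edges lead to pendants and are not counted, pendants of \<open>G\<close> that are
  lost have no incoming edge left, and the loss at the counted edge from \<open>u\<close> to
  \<open>b\<close> is strict.\<close>

lemma star_nonpend:
  assumes G: "minimal_bad G" "c \<in> F G" "S \<subseteq> F G" "c \<notin> S" and K: "minimal_bad K" "below K (shift G {c} S)" "K u b < G u b"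
    and b: "G u b > 0" "b \<notin> pendants G c"
  shows "nonpendant K c < nonpendant G c"
  unfolding nonpendant_def
proof (rule sum_strict2)
  note col = star_col[OF G K(2)]
  show "nonpendant_edge K c x y \<le> nonpendant_edge G c x y" for x y
  proof (cases "y \<in> pendants K c \<or> K x y \<le> 0")
    case True
    then show ?thesis by (auto simp: nonpendant_edge_def)
  next
    case False
    have yS: "y \<notin> S"
    proof
      assume S: "y \<in> S"
      then have "x = c" using col(2)[OF S, of x] False by auto
      then have "K c y = 1" using col(1)[OF S] False by auto
      then show False using pendI[of K c y] col(2)[OF S] False by blast
    qed
    show ?thesis
    proof (rule nonpendant_edge_le)
      show "K x y \<le> max 0 (G x y)" by (rule col(3)[OF yS])
      show "y \<notin> pendants G c" using pend_lost[of y G c K x] col(3)[OF yS] False by blast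
    qed
  qed
  show "nonpendant_edge K c u b < nonpendant_edge G c u b" using K(3) b by (simp add: nonpendant_edge_def)
qed

lemma minimal_bad_not_dom:
  assumes "minimal_bad G"
  obtains v y where "v \<in> F G" "y \<notin> F G" "G v y \<le> 0"
proof -
  have "\<not> dom_in G (F G)" using minimal_badD(2,3)[OF assms] by (auto simp: linked_def)
  then show thesis using that nonempty[OF minimal_badD(1)[OF assms]] by (auto simp: dom_in_def not_less)
qed

text \<open>\<open>center\<close> with all other chosen alternatives as \<open>S\<close>; then
  \<open>B\<close> consists of the unchosen ones not beaten by \<open>v\<close>. Each is the head of
  an edge with a tail other than \<open>v\<close>, and \<open>edge_removal'\<close> keeps it
  unchosen unless a multigraph excluded by \<open>no\<close> appears.\<close>

lemma center_minimal_bad: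
  assumes G: "minimal_bad G" "v \<in> F G" "y \<notin> F G" "G v y \<le> 0"
    and no: "\<And>K S u b. \<lbrakk>minimal_bad K; S \<subseteq> F G; v \<notin> S; below K (shift G {v} S); G u b > 0; K u b < G u b; G v b \<le> 0\<rbrakk> \<Longrightarrow> False"
  shows False
proof -
  define S where "S = F G - {v}"
  define B where "B = {b. b \<noteq> v \<and> b \<notin> S \<and> G v b \<le> 0}"
  have skG: "skew G" by (rule minimal_badD(1)[OF G(1)])
  have BX: "b \<notin> F G" if "b \<in> B" for b using that G(2) by (auto simp: B_def S_def)
  show False
  proof (rule center[OF skG G(2) _ _ B_def])
    show "v \<notin> S" by (simp add: S_def)
    show "G v s \<ge> 0" if "s \<in> S" for s using minimal_bad_inside[OF G(1,2), of s] that by (simp add: S_def)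
    show "B \<noteq> {}" using G by (auto simp: B_def S_def)
    show "F G \<inter> B = {}" using BX by blast
    fix S' assume S': "S' \<subseteq> S"
    let ?H = "shift G {v} S'"
    have vS: "v \<notin> S'" "S' \<subseteq> F G" using S' by (auto simp: S_def)
    have sk: "skew ?H" by (rule skew_shift[OF skG])
    have cn: "linked ?H"
    proof (rule linked_witness[of v y])
      show "v \<noteq> y" using G by blast
      show "?H u v \<le> 0" for u using shift_le[OF vS(1), of G v u] minimal_bad_no_in[OF G(1,2), of u] by simp
      show "\<not> ?H v y > 0" using shift_out[OF vS(1), of G y] G(3,4) vS(2) by auto
      have "y \<noteq> v" using G by blast
      then show "?H y u \<le> 0" for u
        using shift_in[of y v G S' u] minimal_bad_no_out[OF G(1,3), of u] by linarith
    qed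
    show "F ?H = UNIV \<or> F ?H \<inter> B = {}"
    proof (rule ccontr)
      assume "\<not> ?thesis"
      then obtain b where b: "F ?H \<noteq> UNIV" "b \<in> F ?H" "b \<in> B" by blast
      obtain u where u: "G u b > 0" using minimal_bad_head[OF G(1) BX[OF b(3)]] by blast
      have "u \<noteq> v" using u b(3) by (auto simp: B_def)
      then have Hu: "?H u b = G u b" using b(3) by (intro shift_row) (auto simp: B_def)
      have "F ?H = UNIV \<or> u \<in> F ?H \<and> b \<notin> F ?H"
      proof (rule edge_removal'[OF sk cn])
        show "?H u b > 0" using u Hu by simp
        show False if "minimal_bad K" "below K ?H" "K u b < ?H u b" for K
          using no[OF that(1) vS(2,1) that(2) u] that(3) Hu b(3) by (auto simp: B_def)
      qed
      then show False using b by blast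
    qed
  qed
qed

lemma some_pend:
  assumes "minimal_bad G"
  shows "\<exists>K c. minimal_bad K \<and> pendants K c \<noteq> {}"
proof (rule ccontr)
  assume no: "\<not> ?thesis"
  obtain v y where vy: "v \<in> F G" "y \<notin> F G" "G v y \<le> 0" using minimal_bad_not_dom[OF assms] by blast
  show False
  proof (rule center_minimal_bad[OF assms vy])
    show False if "minimal_bad K" "S \<subseteq> F G" "v \<notin> S" "below K (shift G {v} S)" "G u b > 0" "K u b < G u b" "G v b \<le> 0" for K S u b
      using star_pend[OF assms vy(1) that(2,3,1,4,6)] no that(1) by blast
  qed
qed

text \<open>The quantity minimised in the extremal argument: the weight of all edges that do not lead to
  pendants of the centre \<open>c\<close>.\<close>

definition best :: "('a \<Rightarrow> 'a \<Rightarrow> int) \<Rightarrow> 'a \<Rightarrow> bool" where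
  "best G c \<longleftrightarrow> minimal_bad G \<and> pendants G c \<noteq> {} \<and> (\<forall>K d. minimal_bad K \<and> pendants K d \<noteq> {} \<longrightarrow> nonpendant G c \<le> nonpendant K d)"

lemma best_exists:
  assumes "minimal_bad G"
  shows "\<exists>G c. best G c"
proof -
  obtain K c where Kc: "minimal_bad K \<and> pendants K c \<noteq> {}" using some_pend[OF assms] by blast
  let ?P = "\<lambda>p. minimal_bad (fst p) \<and> pendants (fst p) (snd p) \<noteq> {}"
  have "?P (K, c)" using Kc by simp
  then have "\<exists>p. ?P p \<and> (\<forall>q. ?P q \<longrightarrow> nonpendant (fst p) (snd p) \<le> nonpendant (fst q) (snd q))"
    by (rule ex_has_least_nat[of ?P _ "\<lambda>p. nonpendant (fst p) (snd p)"])
  then show ?thesis by (auto simp: best_def)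
qed

lemma best_center:
  assumes "best G c"
  shows "c \<in> F G"
proof -
  have G: "minimal_bad G" and "pendants G c \<noteq> {}" using assms by (simp_all add: best_def)
  then obtain z where "G c z = 1" by (auto simp: pendants_def)
  then show ?thesis using minimal_bad_edge(1)[OF G, of c z] by simp
qed

text \<open>If \<open>c\<close> missed an unchosen alternative, the centre argument at
  \<open>c\<close> would produce a minimal bad multigraph with a pendant of \<open>c\<close> and
  less weight on nonpendant edges.\<close>

lemma best_complete:
  assumes "best G c" "z \<notin> F G"
  shows "G c z > 0"
proof (rule ccontr)
  assume "\<not> G c z > 0"
  then have z: "G c z \<le> 0" by simp
  have G: "minimal_bad G" using assms(1) by (simp add: best_def)
  have c: "c \<in> F G" by (rule best_center[OF assms(1)])
  show False
  proof (rule center_minimal_bad[OF G c assms(2) z])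
    fix K S u b
    assume K: "minimal_bad K" "S \<subseteq> F G" "c \<notin> S" "below K (shift G {c} S)" "G u b > 0" "K u b < G u b" "G c b \<le> 0"
    have "b \<notin> pendants G c" using K(7) by (auto simp: pendants_def)
    then have "nonpendant K c < nonpendant G c" by (rule star_nonpend[OF G c K(2,3,1,4,6,5)])
    moreover have "pendants K c \<noteq> {}" using star_pend[OF G c K(2,3,1,4,6)] by blast
    ultimately show False using assms(1) K(1) by (auto simp: best_def not_le[symmetric])
  qed
qed

end

section \<open>Excluding stars with further edges\<close>

text \<open>A perturbation with two centres, applied with tails of \<open>G\<close> as
  \<open>D\<close> and chosen alternatives without edges as \<open>J\<close>; the latter then
  resemble pendants of \<open>c\<close>.\<close>

definition fork :: "('a \<Rightarrow> 'a \<Rightarrow> int) \<Rightarrow> 'a \<Rightarrow> 'a set \<Rightarrow> 'a \<Rightarrow> 'a set \<Rightarrow> 'a \<Rightarrow> 'a \<Rightarrow> int" where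
  "fork G v D c J = shift (shift G {v} D) {c} J"

definition tails :: "('a \<Rightarrow> 'a \<Rightarrow> int) \<Rightarrow> 'a set" where
  "tails G = {x. \<exists>z. G x z > 0}"

lemma fork_val: "fork G v D c J a b = G a b + (if a = v \<and> b \<in> D then 1 else 0) - (if b = v \<and> a \<in> D then 1 else 0)
    + (if a = c \<and> b \<in> J then 1 else 0) - (if b = c \<and> a \<in> J then 1 else 0)"
  by (simp add: fork_def shift_def)

lemma fork_le: "fork G v D c J a b \<le> G a b + (if a = v \<and> b \<in> D then 1 else 0) + (if a = c \<and> b \<in> J then 1 else 0)"
  by (simp add: fork_val)

context choice
begin

lemma minimal_bad_tails: "minimal_bad G \<Longrightarrow> x \<in> tails G \<Longrightarrow> x \<in> F G"
  using minimal_bad_edge(1)[of G x] unfolding tails_def by blast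

lemma best_tail:
  assumes "best G c"
  shows "c \<in> tails G"
proof -
  obtain z where "G c z = 1" using assms by (auto simp: best_def pendants_def)
  then show ?thesis by (auto simp: tails_def intro!: exI[of _ z])
qed

text \<open>Extremality makes \<open>c\<close> beat every unchosen alternative, in particular a
  nonpendant head; edges from other tails never end in pendants of \<open>c\<close>.\<close>

lemma best_nonpend_edge:
  assumes "best G c" "nonpendant G c > 0" "t \<in> tails G"
  shows "\<exists>b. b \<notin> F G \<and> b \<notin> pendants G c \<and> G t b > 0"
proof (cases "t = c")
  case True
  have G: "minimal_bad G" using assms(1) by (simp add: best_def)
  have "\<exists>u z. nonpendant_edge G c u z > 0"
  proof (rule ccontr)
    assume "\<not> ?thesis"
    then have "nonpendant_edge G c u z = 0" for u z by simp
    then have "nonpendant G c = 0" by (simp add: nonpendant_def)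
    then show False using assms(2) by simp
  qed
  then obtain u z where uz: "nonpendant_edge G c u z > 0" by blast
  then have z: "z \<notin> pendants G c" "G u z > 0" by (auto simp: nonpendant_edge_def split: if_splits)
  have "z \<notin> F G" by (rule minimal_bad_edge(2)[OF G z(2)])
  then show ?thesis using z(1) best_complete[OF assms(1)] True by blast
next
  case False
  have G: "minimal_bad G" using assms(1) by (simp add: best_def)
  obtain b where b: "G t b > 0" using assms(3) by (auto simp: tails_def)
  moreover have "b \<notin> pendants G c"
  proof
    assume "b \<in> pendants G c"
    then have "G t b \<le> 0" using False by (simp add: pendants_def)
    then show False using b by simp
  qed
  ultimately show ?thesis using minimal_bad_edge(2)[OF G b] by blast
qed

text \<open>Such a \<open>K\<close> contradicts the extremal choice of \<open>G\<close> and
  \<open>c\<close>, when measured from \<open>v\<close> or from \<open>c\<close> according to which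
  new edges it contains.\<close>

lemma fork_excluded:
  assumes best: "best G c" "nonpendant G c > 0"
    and v: "v \<in> F G" "v \<noteq> c"
    and D: "D \<subseteq> tails G" "v \<notin> D" and J: "J \<subseteq> F G" "J \<inter> tails G = {}" "v \<notin> J"
    and K: "minimal_bad K" "below K (fork G v D c J)" "K u b < G u b"
    and b: "G u b > 0" "b \<notin> pendants G c"
  shows False
proof -
  have G: "minimal_bad G" "pendants G c \<noteq> {}"
    and least: "\<And>K d. minimal_bad K \<Longrightarrow> pendants K d \<noteq> {} \<Longrightarrow> nonpendant G c \<le> nonpendant K d"
    using best(1) by (auto simp: best_def)
  have c: "c \<in> F G" "c \<in> tails G" "c \<notin> J"
    using best_center[OF best(1)] best_tail[OF best(1)] J(2) by auto
  have DF: "D \<subseteq> F G" using D minimal_bad_tails[OF G(1)] by blast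
  have bF: "b \<notin> F G" by (rule minimal_bad_edge(2)[OF G(1) b(1)])
  have colD: "K x d \<le> (if x = v then 1 else 0)" if "d \<in> D" for x d
  proof -
    have "G x d \<le> 0" using minimal_bad_no_in[OF G(1)] that DF by blast
    moreover have "d \<notin> J" using that D J by blast
    ultimately have "fork G v D c J x d \<le> (if x = v then 1 else 0)"
      using fork_le[of G v D c J x d] by (auto split: if_splits)
    then show ?thesis using belowD[OF K(2), of x d] by (auto split: if_splits)
  qed
  have colJ: "K x j \<le> (if x = c then 1 else 0)" if "j \<in> J" for x j
  proof -
    have "G x j \<le> 0" using minimal_bad_no_in[OF G(1)] that J by blast
    moreover have "j \<notin> D" using that D J by blast
    ultimately have "fork G v D c J x j \<le> (if x = c then 1 else 0)"
      using fork_le[of G v D c J x j] by (auto split: if_splits)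
    then show ?thesis using belowD[OF K(2), of x j] by (auto split: if_splits)
  qed
  have col: "K x z \<le> max 0 (G x z)" if "z \<notin> D" "z \<notin> J" for x z
    using fork_le[of G v D c J x z] that belowD[OF K(2), of x z] by auto
  show False
  proof (cases "\<exists>d\<in>D. K v d > 0")
    case False
    have "below K (shift G {c} J)"
      unfolding below_def
    proof (intro allI)
      fix x z
      show "K x z \<le> max 0 (shift G {c} J x z)"
      proof (cases "z \<in> D")
        case True
        then have "K x z \<le> 0" using colD[OF True, of x] False by (auto split: if_splits)
        then show ?thesis by simp
      next
        case zD: False
        then have "fork G v D c J x z \<le> shift G {c} J x z"
          by (auto simp: fork_val shift_def)
        then show ?thesis using belowD[OF K(2), of x z] by auto
      qed
    qed
    then have "nonpendant K c < nonpendant G c" "pendants K c \<noteq> {}"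
      using star_nonpend[OF G(1) c(1) J(1) c(3) K(1) _ K(3) b] star_pend[OF G(1) c(1) J(1) c(3) K(1) _ K(3)]
      by blast+
    then show False using least[OF K(1), of c] by simp
  next
    case True
    \<comment> \<open>The elements of \<open>D\<close> that still receive their new edge. They are
      heads in \<open>K\<close>, so all their own outgoing edges are gone.\<close>
    define D' where "D' = {d\<in>D. K v d > 0}"
    have D'v: "d \<in> pendants K v" if "d \<in> D'" for d
    proof (rule pendI)
      have d: "d \<in> D" "K v d > 0" using that by (auto simp: D'_def)
      show "K v d = 1" using colD[OF d(1), of v] d(2) by simp
      show "K u d \<le> 0" if "u \<noteq> v" for u using colD[OF d(1), of u] that by simp
    qed
    have D'out: "K d w \<le> 0" if "d \<in> D'" for d w
    proof -
      have "K v d > 0" using that by (simp add: D'_def)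
      then have "d \<notin> F K" by (rule minimal_bad_edge(2)[OF K(1)])
      then show ?thesis by (rule minimal_bad_no_out[OF K(1)])
    qed
    obtain d0 where d0: "d0 \<in> D'" using True by (auto simp: D'_def)
    have pv: "pendants K v \<noteq> {}" using D'v d0 by blast
    have colDv: "x = v \<and> z \<in> D'" if "z \<in> D" "K x z > 0" for x z
      using colD[OF that(1), of x] that by (auto simp: D'_def split: if_splits)
    show False
    proof (cases "c \<in> D'")
      case True
      \<comment> \<open>Here \<open>c\<close> is such a head, so \<open>K\<close> has no edges from
        \<open>c\<close> to \<open>J\<close>, and the counted edge from \<open>c\<close> to
        \<open>b\<close> is lost.\<close>
      have "nonpendant K v < nonpendant G c"
        unfolding nonpendant_def
      proof (rule sum_strict2)
        show "nonpendant_edge K v x z \<le> nonpendant_edge G c x z" for x z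
        proof (cases "K x z \<le> 0 \<or> z \<in> pendants K v")
          case False
          have xc: "x \<noteq> c" using D'out[OF True, of z] False by auto
          have zD: "z \<notin> D" using colDv[of z x] D'v False by auto
          have zJ: "z \<notin> J" using colJ[of z x] xc False by auto
          show ?thesis
          proof (rule nonpendant_edge_le)
            show le: "K x z \<le> max 0 (G x z)" by (rule col[OF zD zJ])
            then show "z \<notin> pendants G c" using False xc by (auto simp: pendants_def)
          qed
        qed (auto simp: nonpendant_edge_def)
        have "G c b > 0" by (rule best_complete[OF best(1) bF])
        then show "nonpendant_edge K v c b < nonpendant_edge G c c b"
          using D'out[OF True, of b] b(2) by (simp add: nonpendant_edge_def)
      qed
      then show False using least[OF K(1) pv] by simp
    next
      case cD': False
      have edge: "\<exists>z. nonpendant_edge G c d z > 0" if d: "d \<in> D'" for d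
      proof -
        have "d \<in> tails G" using d D by (auto simp: D'_def)
        then obtain z where "G d z > 0" "z \<notin> pendants G c"
          using best_nonpend_edge[OF best] by blast
        then show ?thesis by (auto simp: nonpendant_edge_def)
      qed
      show False
      proof (cases "pendants K c = {}")
        case True
        obtain z0 where z0: "nonpendant_edge G c d0 z0 > 0" using edge[OF d0] by blast
        \<comment> \<open>No edge to \<open>J\<close> survives, as its head would be a pendant of
          \<open>c\<close>, and an edge leaving \<open>d0\<close> is lost.\<close>
        have "nonpendant K v < nonpendant G c"
          unfolding nonpendant_def
        proof (rule sum_strict2)
          show "nonpendant_edge K v x z \<le> nonpendant_edge G c x z" for x z
          proof (cases "K x z \<le> 0 \<or> z \<in> pendants K v")
            case False
            have zD: "z \<notin> D" using colDv[of z x] D'v False by auto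
            have zJ: "z \<notin> J"
            proof
              assume j: "z \<in> J"
              have "K c z = 1" using colJ[OF j, of x] colJ[OF j, of c] False by (auto split: if_splits)
              moreover have "K u z \<le> 0" if "u \<noteq> c" for u using colJ[OF j, of u] that by simp
              ultimately have "z \<in> pendants K c" by (rule pendI)
              then show False using True by simp
            qed
            have le: "K u z \<le> max 0 (G u z)" for u by (rule col[OF zD zJ])
            show ?thesis
            proof (rule nonpendant_edge_le)
              show "K x z \<le> max 0 (G x z)" by (rule le)
              show "z \<notin> pendants G c" using pend_lost[of z G c K x] le True False by auto
            qed
          qed (auto simp: nonpendant_edge_def)
          show "nonpendant_edge K v d0 z0 < nonpendant_edge G c d0 z0"
            using z0 D'out[OF d0, of z0] by (simp add: nonpendant_edge_def split: if_splits)
        qed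
        then show False using least[OF K(1) pv] by simp
      next
        case pc: False
        \<comment> \<open>Measured from \<open>c\<close>, each element of \<open>D'\<close> costs at
          most one new edge from \<open>v\<close>, but has lost at least one counted outgoing
          edge.\<close>
        have pt: "nonpendant_edge K c x z \<le> nonpendant_edge G c x z + (if x = v \<and> z \<in> D' then 1 else 0)" for x z
        proof (cases "K x z \<le> 0 \<or> z \<in> pendants K c")
          case False
          show ?thesis
          proof (cases "z \<in> D")
            case True
            then have "x = v \<and> z \<in> D'" using colDv[of z x] False by auto
            moreover have "nonpendant_edge K c x z \<le> 1" using colD[OF True, of x] by (auto simp: nonpendant_edge_def split: if_splits)
            ultimately show ?thesis by simp
          next
            case zD: False
            have zJ: "z \<notin> J"
            proof
              assume j: "z \<in> J"
              have "K c z = 1" using colJ[OF j, of x] colJ[OF j, of c] False by (auto split: if_splits)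
              moreover have "K u z \<le> 0" if "u \<noteq> c" for u using colJ[OF j, of u] that by simp
              ultimately have "z \<in> pendants K c" by (rule pendI)
              then show False using False by simp
            qed
            have le: "K u z \<le> max 0 (G u z)" for u by (rule col[OF zD zJ])
            have "nonpendant_edge K c x z \<le> nonpendant_edge G c x z"
            proof (rule nonpendant_edge_le)
              show "K x z \<le> max 0 (G x z)" by (rule le)
              show "z \<notin> pendants G c" using pend_lost[of z G c K x] le False by auto
            qed
            then show ?thesis by simp
          qed
        qed (auto simp: nonpendant_edge_def)
        have row: "(\<Sum>z\<in>UNIV. nonpendant_edge K c x z) + (if x \<in> D' then 1 else 0)
            \<le> (\<Sum>z\<in>UNIV. nonpendant_edge G c x z) + (if x = v then card D' else 0)" for x
        proof (cases "x \<in> D'")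
          case True
          then have "nonpendant_edge K c x z = 0" for z using D'out by (intro nonpendant_edge_zero) blast
          moreover obtain z where z: "nonpendant_edge G c x z > 0" using edge[OF True] by blast
          have "nonpendant_edge G c x z \<le> (\<Sum>z\<in>UNIV. nonpendant_edge G c x z)" by (rule member_le_sum) auto
          ultimately show ?thesis using z by simp
        next
          case False
          have "(\<Sum>z\<in>UNIV. nonpendant_edge K c x z) \<le> (\<Sum>z\<in>UNIV. nonpendant_edge G c x z + (if x = v \<and> z \<in> D' then 1 else 0))"
            by (rule sum_mono) (rule pt)
          also have "\<dots> = (\<Sum>z\<in>UNIV. nonpendant_edge G c x z) + (\<Sum>z\<in>UNIV. (if x = v \<and> z \<in> D' then 1 else 0))"
            by (rule sum.distrib)
          also have "(\<Sum>z\<in>UNIV. (if x = v \<and> z \<in> D' then 1 else 0)) = (if x = v then card D' else (0::nat))"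
            by (simp add: sum.If_cases)
          finally show ?thesis using False by simp
        qed
        have "nonpendant K c + card D' = (\<Sum>x\<in>UNIV. (\<Sum>z\<in>UNIV. nonpendant_edge K c x z) + (if x \<in> D' then 1 else 0))"
          by (simp add: nonpendant_def sum.distrib sum.If_cases)
        also have "\<dots> \<le> (\<Sum>x\<in>UNIV. (\<Sum>z\<in>UNIV. nonpendant_edge G c x z) + (if x = v then card D' else 0))"
          by (rule sum_mono) (rule row)
        also have "\<dots> = nonpendant G c + card D'"
          by (simp add: nonpendant_def sum.distrib sum.delta)
        finally have "nonpendant K c \<le> nonpendant G c" by simp
        \<comment> \<open>So \<open>K\<close> with \<open>c\<close> is extremal too, and
          \<open>c\<close> would have to beat the unchosen \<open>d0\<close>, which is entered only
          from \<open>v\<close>.\<close>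
        then have "best K c" using K(1) pc least unfolding best_def by (meson order_trans)
        moreover have "d0 \<notin> F K" using minimal_bad_edge(2)[OF K(1), of v d0] d0 by (simp add: D'_def)
        ultimately have "K c d0 > 0" by (rule best_complete)
        moreover have "d0 \<in> D" using d0 by (simp add: D'_def)
        ultimately show False using colD[of d0 c] v(2) by simp
      qed
    qed
  qed
qed

text \<open>Otherwise let \<open>v\<close> be chosen without beating the unchosen \<open>y\<close>.
  Edges from \<open>v\<close> to the other tails keep the choice; then edges from \<open>c\<close>
  to chosen alternatives without edges leave their targets unchosen. In the end \<open>v\<close>
  beats all other chosen alternatives.\<close>

lemma best_nonpend_zero:
  assumes best: "best G c"
  shows "nonpendant G c = 0"
proof (rule ccontr)
  assume "nonpendant G c \<noteq> 0"
  then have pos: "nonpendant G c > 0" by simp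
  have G: "minimal_bad G" using best by (simp add: best_def)
  have skG: "skew G" by (rule minimal_badD(1)[OF G])
  have c: "c \<in> F G" "c \<in> tails G" by (rule best_center[OF best], rule best_tail[OF best])
  obtain v y where v: "v \<in> F G" and y: "y \<notin> F G" "G v y \<le> 0" using minimal_bad_not_dom[OF G] by blast
  have vc: "v \<noteq> c" using best_complete[OF best y(1)] y(2) by auto
  define D where "D = tails G - {v}"
  define J where "J = F G - tails G - {v}"
  have removal: "F (fork G v D0 c J0) = UNIV \<or> u \<in> F (fork G v D0 c J0) \<and> b \<notin> F (fork G v D0 c J0)"
    if sub: "D0 \<subseteq> D" "J0 \<subseteq> J" and b: "b \<notin> pendants G c" "G u b > 0" for D0 J0 u b
  proof (rule edge_removal')
    have bF: "b \<notin> F G" by (rule minimal_bad_edge(2)[OF G b(2)])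
    have ne: "b \<notin> D0" "b \<notin> J0" "b \<noteq> v" "b \<noteq> c" "v \<notin> D0" "v \<notin> J0" "c \<notin> J0" "y \<notin> D0" "y \<notin> J0" "y \<noteq> v" "y \<noteq> c"
      using bF sub v c y minimal_bad_tails[OF G] by (auto simp: D_def J_def)
    show "skew (fork G v D0 c J0)" unfolding fork_def by (intro skew_shift skG)
    have Hub: "fork G v D0 c J0 u b = G u b" using ne by (simp add: fork_val)
    show "fork G v D0 c J0 u b > 0" using Hub b(2) by simp
    show "linked (fork G v D0 c J0)"
    proof (rule linked_witness[of v y])
      show "v \<noteq> y" using ne by blast
      show "fork G v D0 c J0 w v \<le> 0" for w
        using fork_le[of G v D0 c J0 w v] ne minimal_bad_no_in[OF G v, of w] by simp
      show "\<not> fork G v D0 c J0 v y > 0" using fork_le[of G v D0 c J0 v y] ne y(2) by simp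
      show "fork G v D0 c J0 y w \<le> 0" for w
        using fork_le[of G v D0 c J0 y w] ne minimal_bad_no_out[OF G y(1), of w] by simp
    qed
    show False if "minimal_bad K" "below K (fork G v D0 c J0)" "K u b < fork G v D0 c J0 u b" for K
    proof (rule fork_excluded[OF best pos v vc _ _ _ _ _ that(1,2) _ b(2,1)])
      show "K u b < G u b" using that(3) Hub by simp
      show "D0 \<subseteq> tails G" "J0 \<subseteq> F G" "J0 \<inter> tails G = {}" using sub by (auto simp: D_def J_def)
      show "v \<notin> D0" "v \<notin> J0" by (rule ne)+
    qed
  qed
  \<comment> \<open>Every tail has a counted edge, so \<open>removal\<close> keeps it chosen as long
    as the choice is not full.\<close>
  have tails_in: "t \<in> F (fork G v D0 c J0)"
    if sub: "D0 \<subseteq> D" "J0 \<subseteq> J" and nU: "F (fork G v D0 c J0) \<noteq> UNIV" and t: "t \<in> tails G" for D0 J0 t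
  proof -
    obtain b where "b \<notin> pendants G c" "G t b > 0" using best_nonpend_edge[OF best pos t] by blast
    then show ?thesis using removal[OF sub] nU by blast
  qed
  have stepD: "F (fork G v D0 c {}) = F G" if "D0 \<subseteq> D" for D0
    using finite[of D0] that
  proof (induction D0)
    case empty
    then show ?case by (simp add: fork_def)
  next
    case (insert d D0)
    have sk: "skew (fork G v D0 c {})" unfolding fork_def by (intro skew_shift skG)
    have eq: "fork G v (insert d D0) c {} = shift (fork G v D0 c {}) {v} {d}"
      using shift_insert[OF insert(2)] by (simp add: fork_def)
    have d: "d \<noteq> v" "d \<in> tails G" using insert(4) by (auto simp: D_def)
    have IH: "F (fork G v D0 c {}) = F G" using insert by blast
    \<comment> \<open>A change of the choice would have to expel \<open>d\<close>, but
      \<open>d\<close> is a tail.\<close>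
    have "F (fork G v (insert d D0) c {}) = F G \<or> d \<notin> F (fork G v (insert d D0) c {})"
      using raise_chosen[OF sk, of v d] d(1) v minimal_bad_tails[OF G d(2)] unfolding eq IH by blast
    moreover have "d \<in> F (fork G v (insert d D0) c {})" using tails_in[OF insert(4), of "{}" d] d(2) by blast
    ultimately show ?case by blast
  qed
  have stepJ: "tails G \<subseteq> F (fork G v D c J0) \<and> F (fork G v D c J0) \<inter> (- F G \<union> J0) = {}" if "J0 \<subseteq> J" for J0
    using finite[of J0] that
  proof (induction J0)
    case empty
    have "F (fork G v D c {}) = F G" by (rule stepD) simp
    then show ?case using minimal_bad_tails[OF G] by auto
  next
    case (insert j J0)
    let ?V = "F (fork G v D c J0)" and ?W = "F (fork G v D c (insert j J0))"
    have "J0 \<subseteq> J" using insert(4) by simp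
    from insert(3)[OF this] have IH: "tails G \<subseteq> ?V" "?V \<inter> (- F G \<union> J0) = {}" by simp_all
    have sk: "skew (fork G v D c J0)" "skew (fork G v D c (insert j J0))"
      unfolding fork_def by (intro skew_shift skG)+
    have eq: "fork G v D c (insert j J0) = shift (fork G v D c J0) {c} {j}"
      using shift_insert[OF insert(2)] by (simp add: fork_def)
    have jJ: "j \<in> J" using insert(4) by simp
    then have jc: "c \<noteq> j" using c(2) by (auto simp: J_def)
    \<comment> \<open>Pendants of \<open>c\<close> and the elements of \<open>insert j J0\<close>
      have the same column: a single edge from \<open>c\<close>.\<close>
    have twin: "z \<in> ?W \<longleftrightarrow> i \<in> ?W" if z: "z \<in> pendants G c" and i: "i \<in> insert j J0" for z i
    proof (rule twins[OF sk(2)])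
      have iJ: "i \<in> F G" "i \<notin> tails G" "i \<noteq> v" "i \<noteq> c" using i insert(4) c(2) by (auto simp: J_def)
      have i0: "G w i = 0" for w
      proof -
        have "G i w \<le> 0" using iJ(2) by (auto simp: tails_def not_less)
        then show ?thesis using minimal_bad_no_in[OF G iJ(1), of w] skewD[OF skG, of i w] by simp
      qed
      have zF: "z \<notin> F G" using minimal_bad_edge(2)[OF G, of c z] z by (simp add: pendants_def)
      have zne: "z \<noteq> v" "z \<noteq> c" "z \<notin> D" "z \<notin> insert j J0"
        using zF v c insert(4) minimal_bad_tails[OF G] by (auto simp: D_def J_def)
      have inD: "i \<notin> D" using iJ by (auto simp: D_def)
      show "fork G v D c (insert j J0) z i = 0"
        using i0 zne iJ inD by (simp add: fork_val)
      show "fork G v D c (insert j J0) u z = fork G v D c (insert j J0) u i" if "u \<noteq> z" "u \<noteq> i" for u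
      proof -
        have "G u z = (if u = c then 1 else 0)"
          using z minimal_bad_no_out[OF G zF, of u] skewD[OF skG, of u z] by (auto simp: pendants_def intro: antisym)
        moreover have "fork G v D c (insert j J0) u z = G u z" using zne by (simp add: fork_val)
        moreover have "fork G v D c (insert j J0) u i = (if u = c then 1 else 0)"
          using i0 iJ inD i by (simp add: fork_val)
        ultimately show ?thesis by simp
      qed
    qed
    obtain z where z: "z \<in> pendants G c" using best by (auto simp: best_def)
    have zF: "z \<notin> F G" if "z \<in> pendants G c" for z using minimal_bad_edge(2)[OF G, of c z] that by (simp add: pendants_def)
    have all: "?W = UNIV \<or> tails G \<subseteq> ?W" using tails_in[OF subset_refl insert(4)] by blast
    have cV: "c \<in> ?V" using IH(1) c(2) by blast
    \<comment> \<open>Since \<open>c\<close> stays chosen, \<open>swap\<close> leaves two cases: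
      nothing changes, and then \<open>j\<close> is unchosen like its twin \<open>z\<close>, or
      \<open>j\<close> is expelled.\<close>
    have "?W = ?V \<or> j \<notin> ?W"
      using swap[OF sk(1) jc] all c(2) cV unfolding eq by blast
    then have jW: "j \<notin> ?W" using twin[OF z insertI1] IH(2) zF[OF z] by blast
    have sub: "tails G \<subseteq> ?W" using all jW by blast
    have pW: "p \<notin> ?W" if "p \<in> pendants G c" for p using twin[OF that insertI1] jW by blast
    have "i \<notin> ?W" if "i \<in> J0" for i using twin[OF z, of i] pW[OF z] that by blast
    moreover have "b \<notin> ?W" if "b \<notin> F G" for b
    proof (cases "b \<in> pendants G c")
      case False
      obtain u where "G u b > 0" using minimal_bad_head[OF G \<open>b \<notin> F G\<close>] by blast
      then show ?thesis using removal[OF subset_refl insert(4) False, of u] jW by blast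
    qed (rule pW)
    ultimately show ?case using sub jW by auto
  qed
  let ?H = "fork G v D c J"
  have sk: "skew ?H" unfolding fork_def by (intro skew_shift skG)
  have fin: "F ?H \<inter> (- F G \<union> J) = {}" using stepJ[of J] by blast
  show False
  proof (rule beats_chosen_contra[OF sk])
    show "y \<noteq> v" using y v by blast
    have "y \<notin> D" using y(1) minimal_bad_tails[OF G, of y] by (auto simp: D_def)
    then show "?H v y \<le> 0" using fork_le[of G v D c J v y] y(2) vc by simp
    fix x assume x: "x \<in> F ?H" "x \<noteq> v"
    then have "x \<in> F G" "x \<notin> J" using fin by blast+
    then have "x \<in> D" using x(2) by (auto simp: J_def D_def)
    moreover have "G v x = 0" by (rule minimal_bad_inside[OF G v \<open>x \<in> F G\<close>])
    ultimately show "?H v x > 0" using vc x(2) by (simp add: fork_val J_def)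
  qed
qed

end

section \<open>Stars, dominance and robustness\<close>

definition star :: "'a \<Rightarrow> 'a set \<Rightarrow> 'a \<Rightarrow> 'a \<Rightarrow> int" where
  "star c B = shift (\<lambda>_ _. 0) {c} B"

lemma star_val: "star c B a b = (if a = c \<and> b \<in> B then 1 else 0) - (if b = c \<and> a \<in> B then 1 else 0)"
  by (simp add: star_def shift_def)

lemma skew_star: "skew (star c B)"
  unfolding star_def by (intro skew_shift skew_zero)

lemma star_insert: "z \<notin> B \<Longrightarrow> star c (insert z B) = shift (star c B) {c} {z}"
  unfolding star_def by (rule shift_insert)

lemma dom_chain:
  assumes "skew g" "dom_in g X" "dom_in g Y" "x \<in> X" "x \<notin> Y" "y \<in> Y"
  shows "y \<in> X"
proof (rule ccontr)
  assume "y \<notin> X"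
  then have "g x y > 0" "g y x > 0" using assms by (auto simp: dom_in_def)
  then show False using skewD[OF assms(1), of x y] by simp
qed

context choice
begin

text \<open>All weight of \<open>G\<close> lies on its pendant edges.\<close>

lemma best_is_star:
  assumes best: "best G c"
  shows "G = star c (- F G)" 
proof (intro ext)
  fix a b
  have G: "minimal_bad G" using best by (simp add: best_def)
  have skG: "skew G" by (rule minimal_badD(1)[OF G])
  have c: "c \<in> F G" by (rule best_center[OF best])
  have pendants: "z \<in> pendants G c" if z: "z \<notin> F G" for z
  proof (rule ccontr)
    assume p: "z \<notin> pendants G c"
    obtain u where "G u z > 0" using minimal_bad_head[OF G z] by blast
    then have "nonpendant_edge G c u z > 0" using p by (simp add: nonpendant_edge_def)
    moreover have "nonpendant_edge G c u z \<le> (\<Sum>z\<in>UNIV. nonpendant_edge G c u z)" by (rule member_le_sum) auto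
    moreover have "(\<Sum>z\<in>UNIV. nonpendant_edge G c u z) \<le> nonpendant G c"
      unfolding nonpendant_def by (rule member_le_sum[of u UNIV "\<lambda>u. \<Sum>z\<in>UNIV. nonpendant_edge G c u z"]) auto
    ultimately show False using best_nonpend_zero[OF best] by simp
  qed
  have col: "G u z = (if u = c then 1 else 0)" if "z \<notin> F G" for u z
    using pendants[OF that] minimal_bad_no_out[OF G that, of u] skewD[OF skG, of u z] by (auto simp: pendants_def intro: antisym)
  show "G a b = star c (- F G) a b"
  proof (cases "b \<in> F G")
    case False
    then show ?thesis using col[OF False, of a] c by (auto simp: star_val)
  next
    case b: True
    show ?thesis
    proof (cases "a \<in> F G")
      case True
      then show ?thesis using minimal_bad_inside[OF G True b] b by (simp add: star_val)
    next
      case False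
      then show ?thesis using col[OF False, of b] skewD[OF skG, of b a] c b by (auto simp: star_val)
    qed
  qed
qed

section \<open>Excluding stars with unit edges by symmetry\<close>

lemma no_best: 
  assumes best: "best G c"
  shows False
proof -
  have G: "minimal_bad G" using best by (simp add: best_def)
  \<comment> \<open>The plan: with a second chosen alternative \<open>r\<close>, enlarge the star
    until \<open>c\<close> beats all but \<open>r\<close>, and show that an extra edge from
    \<open>r\<close> to \<open>c\<close> does not change the choice. Then \<open>r\<close> beats the
    only other chosen alternative without beating the head \<open>z\<close>.\<close>
  define He where "He = - F G"
  have star: "G = star c He" unfolding He_def by (rule best_is_star[OF best])
  have c: "c \<notin> He" using best_center[OF best] by (simp add: He_def)
  have FG: "F (star c He) = - He" using star by (simp add: He_def)
  have "F G \<noteq> {c}"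
  proof
    assume "F G = {c}"
    then have "dom_in G {c}" by (rule singleton_dom[OF minimal_badD(1)[OF G]])
    then have "{c} = UNIV" using minimal_badD(2)[OF G] unfolding linked_def by blast
    then show False using minimal_badD(3)[OF G] \<open>F G = {c}\<close> by simp
  qed
  then obtain r where r: "r \<notin> He" "r \<noteq> c" using c by (auto simp: He_def)
  obtain z where z: "z \<in> He" using minimal_badD(3)[OF G] by (auto simp: He_def)
  have zne: "z \<noteq> c" "z \<noteq> r" using z c r by auto
  have small: "F (star c B) = UNIV" if B: "B \<subset> He" for B
  proof (rule minimal_badD(4)[OF G skew_star])
    show "below (star c B) G" using B c unfolding star by (auto simp: below_def star_val)
    show "star c B \<noteq> G"
    proof
      obtain w where w: "w \<in> He" "w \<notin> B" using B by blast
      assume "star c B = G"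
      then have "star c B c w = star c He c w" using star by simp
      then show False using w c B by (auto simp: star_val split: if_splits)
    qed
  qed
  \<comment> \<open>A new head is a twin of the old ones and unchosen with them. The remaining
    alternatives are twins of \<open>r\<close>, which stays chosen because \<open>c\<close> alone
    would have to beat \<open>r\<close>.\<close>
  have large: "F (star c (He \<union> T)) = - (He \<union> T)" if "T \<subseteq> - He - {c, r}" for T
    using finite[of T] that
  proof (induction T)
    case empty
    then show ?case using FG by simp
  next
    case (insert j T)
    let ?B = "He \<union> T" and ?C = "insert j (He \<union> T)"
    have j: "j \<notin> He" "j \<noteq> c" "j \<noteq> r" "j \<notin> T" using insert(2,4) by auto
    have cB: "c \<notin> ?C" "r \<notin> ?C" using insert(4) c r j by auto
    have "T \<subseteq> - He - {c, r}" using insert(4) by simp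
    from insert(3)[OF this] have IH: "F (star c ?B) = - ?B" .
    let ?W = "F (star c ?C)"
    have eq: "star c ?C = shift (star c ?B) {c} {j}" by (rule star_insert) (use j in auto)
    have ch: "?W = - ?B \<or> c \<in> ?W \<and> j \<notin> ?W"
      using raise_chosen[OF skew_star, of c j c ?B] j cB unfolding eq IH by auto
    have twin: "x \<in> ?W \<longleftrightarrow> y \<in> ?W" if "x \<in> ?C" "y \<in> ?C" for x y
      by (rule twins[OF skew_star]) (use that cB in \<open>auto simp: star_val\<close>)
    have jW: "j \<notin> ?W" using ch twin[of z j] z by auto
    then have cW: "c \<in> ?W" using ch j by auto
    have out: "x \<notin> ?W" if "x \<in> ?C" for x using twin[OF that insertI1] jW by blast
    have twin': "x \<in> ?W \<longleftrightarrow> r \<in> ?W" if "x \<notin> ?C" "x \<noteq> c" for x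
      by (rule twins[OF skew_star]) (use that cB r in \<open>auto simp: star_val\<close>)
    have "r \<in> ?W"
    proof (rule ccontr)
      assume rW: "r \<notin> ?W"
      have "x = c" if "x \<in> ?W" for x using out[of x] twin'[of x] rW that by blast
      then have "?W = {c}" using cW by blast
      then have "dom_in (star c ?C) {c}" by (rule singleton_dom[OF skew_star])
      then have "star c ?C c r > 0" using r by (simp add: dom_in_def)
      then show False using cB r by (simp add: star_val)
    qed
    then have "x \<in> ?W" if "x \<notin> ?C" for x using twin'[OF that] cW by (cases "x = c") auto
    then have "?W = - ?C" using out by blast
    then show ?case by simp
  qed
  define ok where "ok = (\<lambda>B. c \<notin> B \<and> r \<notin> B \<and> (B \<subseteq> He \<or> He \<subseteq> B))"
  have okF: "F (star c B) = UNIV \<or> F (star c B) = - B" if "ok B" for B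
  proof (cases "B \<subset> He")
    case False
    then have "He \<subseteq> B" using that by (auto simp: ok_def)
    then have "He \<union> B = B" "B \<subseteq> - {c, r}" using that by (auto simp: ok_def)
    moreover have "He \<union> (B - He) = B" using \<open>He \<subseteq> B\<close> by blast
    ultimately show ?thesis using large[of "B - He"] by auto
  qed (use small in blast)
  define g where "g = (\<lambda>B. shift (star c B) {r} {c})"
  have skg: "skew (g B)" for B unfolding g_def by (intro skew_shift skew_star)
  \<comment> \<open>Two ways lead to \<open>g (insert w B)\<close>: raising \<open>c\<close> over
    \<open>w\<close> from \<open>g B\<close> keeps \<open>c\<close>, and raising \<open>r\<close>
    over \<open>c\<close> from the larger star changes nothing or expels \<open>c\<close>.\<close>
  have step: "F (g (insert w B)) = F (star c (insert w B))"
    if w: "w \<notin> B" and ok: "ok B" "ok (insert w B)" and IH: "F (g B) = F (star c B)" for w B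
  proof -
    let ?W = "F (g (insert w B))"
    have wc: "c \<noteq> w" using ok(2) by (auto simp: ok_def)
    have eq: "g (insert w B) = shift (g B) {c} {w}"
      unfolding g_def star_insert[OF w] by (rule shift_commute)
    have cr: "c \<in> F (star c B)" "w \<in> F (star c B)" "c \<in> F (star c (insert w B))" "r \<in> F (star c (insert w B))"
      using okF[OF ok(1)] okF[OF ok(2)] ok w by (auto simp: ok_def)
    have "c \<in> ?W" using raise_chosen[OF skg wc, of B] cr(1,2) unfolding eq IH by blast
    moreover have "?W = F (star c (insert w B)) \<or> c \<notin> ?W"
      using raise_chosen[OF skew_star r(2), of c "insert w B"] cr(3,4) unfolding g_def by blast
    ultimately show ?thesis by blast
  qed
  have chain: "F (g (B \<union> T)) = F (star c (B \<union> T))"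
    if "\<And>T'. T' \<subseteq> T \<Longrightarrow> ok (B \<union> T')" "F (g B) = F (star c B)" "B \<inter> T = {}" for B T
    using finite[of T] that
  proof (induction T)
    case (insert w T)
    have "F (g (B \<union> T)) = F (star c (B \<union> T))"
    proof (rule insert.IH)
      show "ok (B \<union> T')" if "T' \<subseteq> T" for T' by (rule insert.prems(1)) (use that in blast)
    qed (use insert.prems in auto)
    moreover have "ok (B \<union> T)" by (rule insert.prems(1)) blast
    moreover have "ok (insert w (B \<union> T))" using insert.prems(1)[of "insert w T"] by simp
    moreover have "w \<notin> B \<union> T" using insert.hyps insert.prems(3) by blast
    ultimately show ?case using step[of w "B \<union> T"] by simp
  qed simp
  \<comment> \<open>The rotation of \<open>r\<close>, \<open>c\<close>, \<open>z\<close> relates the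
    edge from \<open>c\<close> to \<open>z\<close> to the edge from \<open>r\<close> to
    \<open>c\<close>, and is an automorphism of the three-cycle used below.\<close>
  define p where "p = (\<lambda>x. if x = r then c else if x = c then z else if x = z then r else x)"
  have "bij p"
    by (rule o_bij[of "\<lambda>x. if x = c then r else if x = z then c else if x = r then z else x"])
      (use zne r in \<open>auto simp: p_def fun_eq_iff\<close>)
  have rc: "(\<lambda>x y. star c {z} (p x) (p y)) = star r {c}"
    using zne r(2) by (intro ext) (auto simp: star_val p_def)
  have Frc: "F (star r {c}) = {x. p x \<in> F (star c {z})}"
    using neutr[OF skew_star \<open>bij p\<close>, of c "{z}"] unfolding rc .
  have g0: "g {} = star r {c}" by (simp add: g_def star_def)
  \<comment> \<open>With several heads a single edge and the zero matrix both give full choice, so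
    \<open>B\<close> may be empty. With one head the path from \<open>r\<close> over
    \<open>c\<close> to \<open>z\<close> has to be examined.\<close>
  have base: "\<exists>B. B \<subseteq> He \<and> F (g B) = F (star c B)"
  proof (cases "He = {z}")
    case False
    then have "{z} \<subset> He" using z by blast
    then have "F (star r {c}) = UNIV" using Frc small by simp
    moreover have "F (star c {}) = UNIV" using small[of "{}"] z by blast
    ultimately show ?thesis using g0 by (intro exI[of _ "{}"]) simp
  next
    case True
    let ?W = "F (g {z})"
    have Fz: "F (star c {z}) = - {z}" using FG True by simp
    have "F (star r {c}) = - {c}" using Frc Fz zne r(2) by (auto simp: p_def split: if_splits)
    then have Fg0: "F (g {}) = - {c}" using g0 by simp
    have 1: "?W = - {z} \<or> c \<notin> ?W"
      using raise_chosen[OF skew_star r(2), of c "{z}"] Fz zne r(2) unfolding g_def by auto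
    have "g {z} = shift (g {}) {c} {z}"
      unfolding g_def star_insert[of z "{}" c, simplified] by (rule shift_commute)
    then have 2: "?W = - {c} \<or> c \<in> ?W"
      using swap[OF skg, of c z "{}"] Fg0 zne by auto
    have "?W \<noteq> - {c}"
    proof
      assume W: "?W = - {c}"
      \<comment> \<open>Closing the path to a cycle makes \<open>r\<close>, \<open>c\<close> and
        \<open>z\<close> interchangeable, but raising \<open>z\<close> over \<open>r\<close> at the
        choice \<open>- {c}\<close> either preserves that choice or separates \<open>z\<close> from
        \<open>r\<close>.\<close>
      let ?h = "shift (g {z}) {z} {r}"
      have skh: "skew ?h" by (intro skew_shift skg)
      have inv: "(\<lambda>x y. ?h (p x) (p y)) = ?h"
        using zne r(2) by (intro ext) (auto simp: p_def g_def shift_def star_def)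
      have "F ?h = {x. p x \<in> F ?h}" using neutr[OF skh \<open>bij p\<close>] unfolding inv .
      then have "r \<in> F ?h \<longleftrightarrow> p r \<in> F ?h" "c \<in> F ?h \<longleftrightarrow> p c \<in> F ?h" by blast+
      then have sym: "r \<in> F ?h \<longleftrightarrow> c \<in> F ?h" "c \<in> F ?h \<longleftrightarrow> z \<in> F ?h" using r(2) by (auto simp: p_def)
      have "F ?h = - {c} \<or> z \<in> F ?h \<and> r \<notin> F ?h"
        using raise_chosen[OF skg zne(2), of "{z}"] W zne r(2) by auto
      then show False using sym zne r(2) by auto
    qed
    then have "?W = - {z}" using 1 2 by blast
    then show ?thesis using True Fz by (intro exI[of _ "{z}"]) simp
  qed
  then obtain B where B: "B \<subseteq> He" "F (g B) = F (star c B)" by blast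
  have "F (g (B \<union> (He - B))) = F (star c (B \<union> (He - B)))"
    by (rule chain) (use B c r in \<open>auto simp: ok_def\<close>)
  moreover have "B \<union> (He - B) = He" using B by blast
  ultimately have gHe: "F (g He) = F (star c He)" by simp
  let ?T = "- He - {c, r}"
  have "F (g (He \<union> ?T)) = F (star c (He \<union> ?T))"
    by (rule chain) (use gHe c r in \<open>auto simp: ok_def\<close>)
  also have "\<dots> = - (He \<union> ?T)" by (rule large) simp
  finally have fin: "F (g (He \<union> ?T)) = {c, r}" using c r by auto
  show False
  proof (rule beats_chosen_contra[OF skg, of "He \<union> ?T" r z])
    show "z \<noteq> r" by (rule zne)
    show "g (He \<union> ?T) r z \<le> 0" using zne r(2) by (simp add: g_def shift_def star_val)
    show "g (He \<union> ?T) r x > 0" if "x \<in> F (g (He \<union> ?T))" "x \<noteq> r" for x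
      using that r c unfolding fin by (auto simp: g_def shift_def star_val)
  qed
qed

section \<open>Full choice on linked matrices and dominance of the choice set\<close>

theorem connected_all:
  assumes "skew g" "linked g"
  shows "F g = UNIV"
  using minimal_bad_exists[OF assms] best_exists no_best by blast

text \<open>At a violating matrix whose smaller-weight matrices all satisfy the claim, an edge leads
  out of the chosen set, or into it from a dominant set. The latter contradicts
  \<open>beats_chosen\<close>; if only the former occurs, the matrix is linked.\<close>

theorem dominant_F: "skew g \<Longrightarrow> dom_in g (F g)"
proof (induction "weight g" arbitrary: g rule: less_induct)
  case (less h)
  note sk = less.prems
  define X where "X = F h"
  show ?case
  proof (rule ccontr)
    assume "\<not> dom_in h (F h)"
    then have bad: "\<not> dom_in h X" by (simp add: X_def)
    have edge: "a \<in> X \<and> b \<notin> X \<or> a \<notin> X \<and> b \<in> X \<and> (\<exists>Y. dom_in h Y \<and> a \<in> Y \<and> b \<notin> Y)"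
      if ab: "h a b > 0" for a b
    proof -
      \<comment> \<open>Deleting one unit of the edge gives a dominant choice \<open>Y\<close>,
        which is dominant in \<open>h\<close> as well and hence different from
        \<open>X\<close>.\<close>
      let ?L = "shift h {b} {a}"
      define Y where "Y = F ?L"
      have ne: "a \<noteq> b" by (rule pos_ne[OF sk ab])
      have skL: "skew ?L" by (rule skew_shift[OF sk])
      have domL: "dom_in ?L Y" unfolding Y_def by (rule less.hyps[OF weight_lower[OF sk ab] skL])
      have dom: "dom_in h Y"
        using domL below_pos[OF lower_below[OF sk ab]] unfolding dom_in_def by (meson order_less_le_trans)
      have "shift ?L {a} {b} = h" using ne by (intro shift_back) simp
      then have sw: "X = Y \<or> a \<notin> Y \<and> a \<in> X \<and> b \<in> Y \<or> a \<in> Y \<and> a \<in> X \<and> b \<in> Y \<and> b \<notin> X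
          \<or> a \<in> Y \<and> a \<notin> X \<and> b \<notin> Y \<and> b \<in> X"
        using swap[OF skL ne] unfolding X_def Y_def by auto
      have "\<not> (a \<notin> Y \<and> b \<in> Y)"
      proof
        assume "a \<notin> Y \<and> b \<in> Y"
        then have "?L b a > 0" using domL by (auto simp: dom_in_def)
        then show False using ab skewD[OF sk, of a b] ne by (simp add: shift_single)
      qed
      then show ?thesis using sw dom bad by blast
    qed
    show False
    proof (cases "\<exists>a b Y. a \<notin> X \<and> b \<in> X \<and> dom_in h Y \<and> a \<in> Y \<and> b \<notin> Y")
      case True
      then obtain a b Y where Y: "a \<notin> X" "b \<in> X" "dom_in h Y" "a \<in> Y" "b \<notin> Y" by blast
      \<comment> \<open>All of \<open>Y\<close> beats \<open>b\<close>, and an edge into the chosen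
        \<open>b\<close> has an unchosen tail. So \<open>Y\<close> is disjoint from
        \<open>X\<close>, and \<open>a\<close> beats every element of \<open>X\<close>.\<close>
      have "y \<notin> X" if "y \<in> Y" for y
      proof -
        have "h y b > 0" using Y that by (auto simp: dom_in_def)
        then show ?thesis using edge[of y b] Y(2) by blast
      qed
      then have "h a x > 0" if "x \<in> X" for x using Y that by (auto simp: dom_in_def)
      then have "F h = {a}" by (intro beats_chosen[OF sk]) (simp add: X_def)
      then show False using Y(1) by (simp add: X_def)
    next
      case False
      then have edge': "a \<in> X \<and> b \<notin> X" if "h a b > 0" for a b using edge[OF that] by blast
      have "linked h"
        unfolding linked_def
      proof (intro allI impI, rule ccontr)
        fix Z assume Z: "dom_in h Z" "Z \<noteq> UNIV"
        then obtain w z where wz: "w \<notin> Z" "z \<in> Z" by (auto simp: dom_in_def)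
        have "a \<in> X \<and> b \<notin> X" if "a \<in> Z" "b \<notin> Z" for a b
          using edge'[of a b] Z(1) that by (auto simp: dom_in_def)
        then have "Z = X" using wz by blast
        then show False using Z bad by simp
      qed
      then have "X = UNIV" unfolding X_def by (rule connected_all[OF sk])
      then show False using bad by (simp add: dom_in_def)
    qed
  qed
qed

section \<open>Robustness of the choice function\<close>

lemma tie_chosen:
  assumes sk: "skew g" and X: "X \<subseteq> F g"
  shows "F (\<lambda>a b. if a \<in> X \<and> b \<in> X then 0 else g a b) = F g" (is "F ?h = _")
proof -
  have skh: "skew ?h"
  proof (rule skewI)
    fix a b show "?h b a = - ?h a b" using skewD[OF sk, of a b] by auto
  qed
  show ?thesis
  proof (rule step_induct[of g ?h "\<lambda>k. F k = F g", OF sk skh refl])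
    fix k x y
    assume k: "skew k" "F k = F g" "k x y < ?h x y"
      and bd: "\<And>a b. g a b \<le> ?h a b \<Longrightarrow> g a b \<le> k a b \<and> k a b \<le> ?h a b"
    have ne: "x \<noteq> y" using k(3) skew_diag[OF k(1), of x] skew_diag[OF skh, of x] by auto
    have xy: "x \<in> X" "y \<in> X" using bd[of x y] k(3) by (auto split: if_splits)
    let ?W = "F (shift k {x} {y})"
    have "?W = F k \<or> x \<in> ?W \<and> y \<notin> ?W"
      by (rule raise_chosen[OF k(1) ne]) (use xy X k(2) in auto)
    \<comment> \<open>A new choice that contains \<open>x\<close> and misses \<open>y\<close> is
      dominant only if \<open>x\<close> beats \<open>y\<close>, but \<open>k x y\<close> was
      negative before the unit shift.\<close>
    moreover have "\<not> (x \<in> ?W \<and> y \<notin> ?W)"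
    proof
      assume "x \<in> ?W \<and> y \<notin> ?W"
      then have "shift k {x} {y} x y > 0"
        using dominant_F[OF skew_shift[OF k(1)], of "{x}" "{y}"] by (auto simp: dom_in_def)
      then show False using k(3) xy ne by (simp add: shift_single)
    qed
    ultimately show "?W = F g" using k(2) by blast
  qed
qed

text \<open>Scale \<open>h\<close> until it is at least \<open>g\<close> on entries leaving
  \<open>X\<close>, and replace \<open>g\<close> by it everywhere except inside \<open>X\<close>;
  the choice stays \<open>X\<close>. If \<open>F h\<close> were not contained in \<open>X\<close>,
  it would include \<open>X\<close>, and tying the elements of \<open>X\<close> makes both matrices
  equal without changing their choices.\<close>

theorem robust_F:
  assumes g: "skew g" and h: "skew h" and dom: "dom_in h (F g)"
  shows "F h \<subseteq> F g"
proof -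
  define X where "X = F g"
  define M where "M = (\<Sum>a\<in>UNIV. \<Sum>b\<in>UNIV. \<bar>g a b\<bar>)"
  have M: "g a b \<le> M" for a b
  proof -
    have "\<bar>g a b\<bar> \<le> (\<Sum>b\<in>UNIV. \<bar>g a b\<bar>)" by (rule member_le_sum) auto
    also have "\<dots> \<le> M" unfolding M_def
      by (rule member_le_sum[of a UNIV "\<lambda>a. \<Sum>b\<in>UNIV. \<bar>g a b\<bar>"]) (auto intro: sum_nonneg)
    finally show ?thesis by simp
  qed
  have M0: "M \<ge> 0" unfolding M_def by (intro sum_nonneg) simp
  define n where "n = nat M + 1"
  have n: "int n = M + 1" "n > 0" using M0 by (auto simp: n_def)
  define h' where "h' = (\<lambda>a b. int n * h a b)"
  have skh': "skew h'" unfolding h'_def by (rule skew_mult[OF h])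
  have Fh': "F h' = F h" unfolding h'_def by (rule homog[OF h n(2)])
  have cross: "g x z \<le> h' x z" if "x \<in> X" "z \<notin> X" for x z
  proof -
    have "h x z > 0" using dom that by (auto simp: dom_in_def X_def)
    then have "int n * 1 \<le> int n * h x z" by (intro mult_left_mono) auto
    then show ?thesis using M[of x z] n(1) unfolding h'_def by linarith
  qed
  have domh': "dom_in h' X" using dom n(2) by (auto simp: dom_in_def X_def h'_def)
  define g1 where "g1 = (\<lambda>a b. if a \<in> X \<and> b \<in> X then g a b else h' a b)"
  have skg1: "skew g1"
  proof (rule skewI)
    fix a b show "g1 b a = - g1 a b"
      using skewD[OF g, of a b] skewD[OF skh', of a b] by (auto simp: g1_def)
  qed
  have Fg1: "F g1 = X"
  proof (rule step_induct[of g g1 "\<lambda>k. F k = X", OF g skg1])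
    show "F g = X" by (simp add: X_def)
    fix k x y
    assume k: "skew k" "F k = X" "k x y < g1 x y"
      and bd: "\<And>a b. g a b \<le> g1 a b \<Longrightarrow> g a b \<le> k a b \<and> k a b \<le> g1 a b"
    have ne: "x \<noteq> y" using k(3) skew_diag[OF k(1), of x] skew_diag[OF skg1, of x] by auto
    let ?k = "shift k {x} {y}"
    have sk: "skew ?k" by (rule skew_shift[OF k(1)])
    have yX: "y \<notin> X"
    proof
      assume y: "y \<in> X"
      have "g y x \<le> g1 y x" using cross[OF y, of x] y by (simp add: g1_def)
      then have "k y x \<le> g1 y x" using bd by blast
      then show False using k(3) skewD[OF k(1), of x y] skewD[OF skg1, of x y] by simp
    qed
    show "F ?k = X"
    proof (cases "x \<in> X")
      case False
      then show ?thesis using raise_unchosen[OF k(1) ne] yX k(2) by simp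
    next
      case True
      have "dom_in k X" using dominant_F[OF k(1)] k(2) by simp
      moreover have "k a b \<le> ?k a b" if "a \<in> X" "b \<notin> X" for a b
        using that True yX ne by (auto simp: shift_single)
      ultimately have "dom_in ?k X" unfolding dom_in_def by (meson ComplD order_less_le_trans)
      moreover have "dom_in ?k (F ?k)" by (rule dominant_F[OF sk])
      ultimately have "\<not> (x \<notin> F ?k \<and> y \<in> F ?k)"
        using dom_chain[OF sk, of X "F ?k" x y] True yX by blast
      then show ?thesis using swap[OF k(1) ne] True yX k(2) by blast
    qed
  qed
  show ?thesis
  proof (rule ccontr)
    assume "\<not> F h \<subseteq> F g"
    then obtain w where w: "w \<in> F h'" "w \<notin> X" using Fh' by (auto simp: X_def)
    have "X \<subseteq> F h'"
      using dom_chain[OF skh' dominant_F[OF skh'] domh' w] by blast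
    then have "F (\<lambda>a b. if a \<in> X \<and> b \<in> X then 0 else h' a b) = F h'" by (rule tie_chosen[OF skh'])
    moreover have "F (\<lambda>a b. if a \<in> X \<and> b \<in> X then 0 else g1 a b) = F g1"
      by (rule tie_chosen[OF skg1]) (simp add: Fg1)
    moreover have "(\<lambda>a b. if a \<in> X \<and> b \<in> X then 0 else g1 a b) = (\<lambda>a b. if a \<in> X \<and> b \<in> X then 0 else h' a b)"
      by (auto simp: g1_def fun_eq_iff)
    ultimately have "F h' = X" using Fg1 by simp
    then show False using w by blast
  qed
qed

end

section \<open>From profiles to margin matrices\<close>

definition vote :: "'a rel \<Rightarrow> 'a \<Rightarrow> 'a \<Rightarrow> int" where
  "vote r x y = of_bool ((x, y) \<in> r) - of_bool ((y, x) \<in> r)"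

lemma margin_sum: "finite (dom R) \<Longrightarrow> margin R x y = (\<Sum>i\<in>dom R. vote (pref R i) x y)"
  by (simp add: margin_def vote_def sum_subtractf of_bool_def sum.If_cases Int_def)

lemma skew_margin: "skew (margin R)"
  by (rule skewI) (simp add: margin_def)

lemma valid_finite: "valid_profile R \<Longrightarrow> finite (dom R)"
  by (simp add: valid_profile_def)

lemma maj_strict_iff: "maj_strict R x y \<longleftrightarrow> margin R x y > 0"
  by (auto simp: maj_strict_def maj_weak_def margin_def)

lemma dominant_iff: "dominant R X \<longleftrightarrow> dom_in (margin R) X"
  by (auto simp: dominant_def dom_in_def maj_strict_iff)

lemma margin_new:
  assumes "valid_profile R" "i \<notin> dom R"
  shows "margin (R(i \<mapsto> r)) x y = margin R x y + vote r x y"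
proof -
  have "margin (R(i \<mapsto> r)) x y = (\<Sum>j\<in>insert i (dom R). vote (pref (R(i \<mapsto> r)) j) x y)"
    using valid_finite[OF assms(1)] by (simp add: margin_sum)
  also have "\<dots> = vote r x y + (\<Sum>j\<in>dom R. vote (pref (R(i \<mapsto> r)) j) x y)"
    using valid_finite[OF assms(1)] assms(2) by (simp add: pref_def)
  also have "(\<Sum>j\<in>dom R. vote (pref (R(i \<mapsto> r)) j) x y) = (\<Sum>j\<in>dom R. vote (pref R j) x y)"
    using assms(2) by (intro sum.cong) (auto simp: pref_def)
  finally show ?thesis using margin_sum[OF valid_finite[OF assms(1)], of x y] by linarith
qed

lemma margin_change:
  assumes "valid_profile R" "dom R = dom R'" "i \<in> dom R" "\<forall>j\<in>dom R. j \<noteq> i \<longrightarrow> R j = R' j"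
  shows "margin R' x y = margin R x y - vote (pref R i) x y + vote (pref R' i) x y"
proof -
  have fin: "finite (dom R)" by (rule valid_finite[OF assms(1)])
  have "(\<Sum>j\<in>dom R - {i}. vote (pref R j) x y) = (\<Sum>j\<in>dom R - {i}. vote (pref R' j) x y)"
    using assms(4) by (intro sum.cong) (auto simp: pref_def)
  moreover have "margin R x y = vote (pref R i) x y + (\<Sum>j\<in>dom R - {i}. vote (pref R j) x y)"
    unfolding margin_sum[OF fin] by (rule sum.remove[OF fin assms(3)])
  moreover have "margin R' x y = vote (pref R' i) x y + (\<Sum>j\<in>dom R - {i}. vote (pref R' j) x y)"
    unfolding margin_sum[OF fin[unfolded assms(2)]] assms(2)
    by (rule sum.remove) (use fin assms in auto)
  ultimately show ?thesis by simp
qed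

lemma valid_upd:
  assumes "valid_profile R" "strict_linear_order r" "i \<noteq> 0"
  shows "valid_profile (R(i \<mapsto> r))"
  using assms by (auto simp: valid_profile_def)

lemma fresh_voter:
  assumes "valid_profile R"
  obtains i where "i \<notin> dom R" "i \<noteq> 0"
proof -
  have "finite (insert 0 (dom R))" using valid_finite[OF assms] by simp
  then obtain i where "i \<notin> insert 0 (dom R)" using ex_new_if_finite[OF infinite_UNIV_nat] by blast
  then show thesis using that by blast
qed

lemma strict_linear_converse: "strict_linear_order r \<Longrightarrow> strict_linear_order (r\<inverse>)"
  by (auto simp: strict_linear_order_on_def)

lemma vote_converse: "vote (r\<inverse>) x y = - vote r x y"
  by (simp add: vote_def)

lemma two_voters:
  assumes "valid_profile R" "strict_linear_order r" "strict_linear_order s"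
  obtains R' i where "valid_profile R'" "i \<in> dom R'" "pref R' i = r"
    "\<And>x y. margin R' x y = margin R x y + vote r x y + vote s x y"
proof -
  obtain i where i: "i \<notin> dom R" "i \<noteq> 0" using fresh_voter[OF assms(1)] by blast
  have 1: "valid_profile (R(i \<mapsto> r))" by (rule valid_upd[OF assms(1,2) i(2)])
  obtain j where j: "j \<notin> dom (R(i \<mapsto> r))" "j \<noteq> 0" using fresh_voter[OF 1] by blast
  have 2: "valid_profile (R(i \<mapsto> r, j \<mapsto> s))" by (rule valid_upd[OF 1 assms(3) j(2)])
  show thesis
  proof (rule that[OF 2])
    show "i \<in> dom (R(i \<mapsto> r, j \<mapsto> s))" by simp
    show "pref (R(i \<mapsto> r, j \<mapsto> s)) i = r" using j(1) by (auto simp: pref_def)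
    show "margin (R(i \<mapsto> r, j \<mapsto> s)) x y = margin R x y + vote r x y + vote s x y" for x y
      using margin_new[OF 1 j(1)] margin_new[OF assms(1) i(1)] by simp
  qed
qed

section \<open>Orders given by keys and the realization of even matrices\<close>

definition key_ord :: "('a \<Rightarrow> nat) \<Rightarrow> ('a \<Rightarrow> nat) \<Rightarrow> 'a rel" where
  "key_ord e k = {(a, b). k a < k b \<or> k a = k b \<and> e a < e b}"

lemma strict_linear_key_ord:
  assumes "inj e"
  shows "strict_linear_order (key_ord e k)"
proof -
  have "e x < e y \<or> e y < e x" if "x \<noteq> y" for x y
    using injD[OF assms, of x y] that by linarith
  then show ?thesis
    by (auto simp: strict_linear_order_on_def key_ord_def trans_def irrefl_def total_on_def)
qed

text \<open>Smaller keys rank higher and \<open>x\<close> directly follows \<open>y\<close>, so the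
  exchange reverses only this pair.\<close>

lemma vote_key_ord_swap:
  assumes "k y < k x" "\<And>w. w \<noteq> x \<Longrightarrow> w \<noteq> y \<Longrightarrow> k w < k y \<or> k x < k w"
  shows "vote (key_ord e (k(x := k y, y := k x))) a b - vote (key_ord e k) a b = 2 * (shift g {x} {y} a b - g a b)"
proof -
  have ne: "x \<noteq> y" using assms(1) by auto
  show ?thesis
    using assms(1) assms(2)[of a] assms(2)[of b] ne
    by (cases "a = x"; cases "a = y"; cases "b = x"; cases "b = y")
      (auto simp: vote_def key_ord_def shift_single)
qed

text \<open>Two opposite voters realize the zero matrix. A unit shift is realized by two further
  voters who disagree on every pair except that both put \<open>x\<close> above
  \<open>y\<close>.\<close>

lemma realizable:
  fixes g :: "'a::finite \<Rightarrow> 'a \<Rightarrow> int"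
  assumes "skew g"
  shows "\<exists>R. valid_profile R \<and> margin R = (\<lambda>x y. 2 * g x y)"
proof -
  obtain e :: "'a \<Rightarrow> nat" where e: "inj e"
    using finite_imp_inj_to_nat_seg[of "UNIV :: 'a set"] by auto
  define r where "r = key_ord e (\<lambda>_. 0)"
  have r: "strict_linear_order r" unfolding r_def by (rule strict_linear_key_ord[OF e])
  show ?thesis
  proof (rule step_induct[of "\<lambda>_ _. 0" g "\<lambda>g. \<exists>R. valid_profile R \<and> margin R = (\<lambda>x y. 2 * g x y)",
        OF skew_zero assms])
    let ?R = "[1 \<mapsto> r, 2 \<mapsto> r\<inverse>]"
    have 0: "valid_profile [1::nat \<mapsto> r]" using r by (auto simp: valid_profile_def)
    have "valid_profile ?R" by (rule valid_upd[OF 0 strict_linear_converse[OF r]]) simp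
    moreover have "margin ?R x y = 0" for x y
    proof -
      have "dom [1::nat \<mapsto> r] = {1}" by simp
      then have "margin [1::nat \<mapsto> r] x y = vote r x y" by (simp add: margin_sum pref_def)
      then show ?thesis using margin_new[OF 0, of 2] by (simp add: vote_converse)
    qed
    then have "margin ?R = (\<lambda>x y. 2 * 0)" by (intro ext) simp
    ultimately show "\<exists>R :: 'a profile. valid_profile R \<and> margin R = (\<lambda>x y. 2 * 0)" by blast
  next
    fix k :: "'a \<Rightarrow> 'a \<Rightarrow> int" and x y
    assume "skew k" "\<exists>R. valid_profile R \<and> margin R = (\<lambda>x y. 2 * k x y)" "k x y < g x y"
    then obtain R where R: "valid_profile R" "margin R = (\<lambda>x y. 2 * k x y)"
      and ne: "x \<noteq> y" using skew_diag[of k x] skew_diag[OF assms, of x] by force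
    define q where "q = (\<lambda>w. if w = y then 0 else if w = x then 1 else (2::nat))"
    have q: "q y < q x" "\<And>w. w \<noteq> x \<Longrightarrow> w \<noteq> y \<Longrightarrow> q w < q y \<or> q x < q w"
      using ne by (auto simp: q_def)
    obtain R' where "valid_profile R'" and m: "\<And>a b. margin R' a b = margin R a b
        + vote (key_ord e (q(x := q y, y := q x))) a b + vote ((key_ord e q)\<inverse>) a b"
      using two_voters[OF R(1) strict_linear_key_ord[OF e] strict_linear_converse[OF strict_linear_key_ord[OF e]]]
      by metis
    moreover have "margin R' a b = 2 * shift k {x} {y} a b" for a b
      using m[of a b] vote_key_ord_swap[OF q, of e a b k] R(2) by (simp add: vote_converse)
    then have "margin R' = (\<lambda>a b. 2 * shift k {x} {y} a b)" by (intro ext)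
    ultimately show "\<exists>R. valid_profile R \<and> margin R = (\<lambda>a b. 2 * shift k {x} {y} a b)" by blast
  qed
qed

lemma copies_exist:
  assumes R: "valid_profile R" and k: "k > 0"
  shows "\<exists>R'. valid_profile R' \<and> copies k R R' \<and> margin R' = (\<lambda>x y. int k * margin R x y)"
proof -
  \<comment> \<open>Voter \<open>i\<close> is copied to the \<open>k\<close> consecutive voters
    starting at \<open>(i - 1) * k + 1\<close>; the offset keeps voter 0 out.\<close>
  define h where "h = (\<lambda>j :: nat. (j - 1) div k + 1)"
  define R' where "R' = (\<lambda>j. if j = 0 then None else R (h j))"
  have dom: "j \<in> dom R' \<longleftrightarrow> j \<noteq> 0 \<and> h j \<in> dom R" for j
    by (simp add: R'_def dom_def)
  have fiber: "{j \<in> dom R'. h j = i} = (\<lambda>t. (i - 1) * k + 1 + t) ` {..<k}" if i: "i \<in> dom R" for i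
  proof -
    have i0: "i \<noteq> 0" using i R by (auto simp: valid_profile_def)
    show ?thesis
    proof (intro equalityI subsetI)
      fix j assume "j \<in> {j \<in> dom R'. h j = i}"
      then have j: "j \<noteq> 0" "h j = i" using dom by auto
      have "(j - 1) div k * k + (j - 1) mod k = j - 1" by (rule div_mult_mod_eq)
      then have "j = (i - 1) * k + 1 + (j - 1) mod k" using j by (auto simp: h_def)
      then show "j \<in> (\<lambda>t. (i - 1) * k + 1 + t) ` {..<k}" using k by auto
    next
      fix j assume "j \<in> (\<lambda>t. (i - 1) * k + 1 + t) ` {..<k}"
      then obtain t where t: "t < k" "j = (i - 1) * k + 1 + t" by blast
      then have "h j = i" using i0 by (simp add: h_def)
      then show "j \<in> {j \<in> dom R'. h j = i}" using dom i t by simp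
    qed
  qed
  have card: "card {j \<in> dom R'. h j = i} = k" if "i \<in> dom R" for i
    unfolding fiber[OF that] by (subst card_image) (auto simp: inj_on_def)
  have finR: "finite (dom R)" by (rule valid_finite[OF R])
  have "dom R' = (\<Union>i\<in>dom R. {j \<in> dom R'. h j = i})" using dom by blast
  also have "finite \<dots>" using finR fiber by auto
  finally have fin: "finite (dom R')" .
  have "dom R' \<noteq> {}"
  proof -
    have "dom R \<noteq> {}" using R by (simp add: valid_profile_def)
    then obtain i where i: "i \<in> dom R" by blast
    have "{j \<in> dom R'. h j = i} \<noteq> {}" using card[OF i] k by (metis card.empty less_irrefl)
    then show ?thesis by blast
  qed
  moreover have "the (R' j) = the (R (h j))" if "j \<in> dom R'" for j using that dom by (simp add: R'_def)
  ultimately have valid: "valid_profile R'" using R fin dom unfolding valid_profile_def by auto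
  have cop: "copies k R R'"
    unfolding copies_def using card dom by (intro exI[of _ h]) (auto simp: R'_def)
  have "margin R' x y = int k * margin R x y" for x y
  proof -
    have "margin R' x y = (\<Sum>j\<in>dom R'. vote (pref R (h j)) x y)"
      unfolding margin_sum[OF fin] using dom by (intro sum.cong) (auto simp: pref_def R'_def)
    also have "\<dots> = (\<Sum>i\<in>dom R. \<Sum>j\<in>{j \<in> dom R'. h j = i}. vote (pref R (h j)) x y)"
      by (rule sum.group[symmetric]) (use fin finR dom in auto)
    also have "\<dots> = (\<Sum>i\<in>dom R. int k * vote (pref R i) x y)"
      using card by (intro sum.cong) simp_all
    finally show ?thesis by (simp add: margin_sum[OF finR] sum_distrib_left)
  qed
  then show ?thesis using valid cop by blast
qed

lemma strict_linear_inv_image: "strict_linear_order r \<Longrightarrow> inj p \<Longrightarrow> strict_linear_order (inv_image r p)"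
  by (auto simp: strict_linear_order_on_def irrefl_def total_on_def inj_eq intro: trans_inv_image)

text \<open>Every even skew matrix is the margin matrix of some profile, and doubling a profile makes its
  margins even; therefore \<open>g\<close> stands for the margins \<open>2 * g\<close>, and one voter exchanging two adjacent
  alternatives shifts \<open>g\<close> by one unit.\<close>

definition scc_margin :: "('a profile \<Rightarrow> 'a set) \<Rightarrow> ('a \<Rightarrow> 'a \<Rightarrow> int) \<Rightarrow> 'a set" where
  "scc_margin f g = f (SOME R. valid_profile R \<and> margin R = (\<lambda>x y. 2 * g x y))"

lemma scc_margin_eq:
  assumes "pairwise_scc f" "valid_profile R" "margin R = (\<lambda>x y. 2 * g x y)"
  shows "scc_margin f g = f R"
proof -
  let ?P = "\<lambda>R. valid_profile R \<and> margin R = (\<lambda>x y. 2 * g x y)"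
  define S where "S = (SOME R. ?P R)"
  have "?P S" unfolding S_def using assms(2,3) by (intro someI[of ?P R]) (rule conjI)
  then have "f S = f R"
    using assms(1)[unfolded pairwise_scc_def, rule_format, of S R] assms(2,3) by simp
  then show ?thesis by (simp add: scc_margin_def S_def)
qed

text \<open>At \<open>margin R\<close> the map \<open>scc_margin f\<close> refers to profiles with
  doubled margins, such as two copies of \<open>R\<close>; homogeneity leads back to
  \<open>R\<close>.\<close>

lemma scc_margin_profile:
  assumes "pairwise_scc f" "homogeneous f" "valid_profile R"
  shows "scc_margin f (margin R) = f R"
proof -
  obtain R' where R': "valid_profile R'" "copies 2 R R'" "margin R' = (\<lambda>x y. int 2 * margin R x y)"
    using copies_exist[OF assms(3), of 2] by auto
  have "f R' = f R"
    using assms(2)[unfolded homogeneous_def, rule_format, of R R' 2] assms(3) R'(1,2) by simp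
  moreover have "scc_margin f (margin R) = f R'" using R' by (intro scc_margin_eq[OF assms(1)]) simp_all
  ultimately show ?thesis by simp
qed

section \<open>Manipulations by a single voter\<close>

lemma no_manipulation:
  fixes f :: "'a::finite profile \<Rightarrow> 'a set"
  assumes f: "pairwise_scc f" "strategyproof f" and g: "skew g"
    and r: "strict_linear_order r" "strict_linear_order s"
    and diff: "\<And>x y. vote s x y - vote r x y = 2 * (h x y - g x y)"
  shows "\<not> fishburn r (scc_margin f h) (scc_margin f g)"
proof -
  obtain R0 where R0: "valid_profile R0" "margin R0 = (\<lambda>x y. 2 * g x y)" using realizable[OF g] by blast
  \<comment> \<open>Adding a voter with preference \<open>r\<close> and one with its converse keeps
    the margins \<open>2 * g\<close>; by reporting \<open>s\<close> the former turns them into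
    \<open>2 * h\<close>.\<close>
  obtain R i where R: "valid_profile R" "i \<in> dom R" "pref R i = r"
    and m: "\<And>x y. margin R x y = margin R0 x y + vote r x y + vote (r\<inverse>) x y"
    using two_voters[OF R0(1) r(1) strict_linear_converse[OF r(1)]] by metis
  have mR: "margin R = (\<lambda>x y. 2 * g x y)" using m R0(2) by (simp add: vote_converse fun_eq_iff)
  define R' where "R' = R(i \<mapsto> s)"
  have i0: "i \<noteq> 0" using R by (auto simp: valid_profile_def)
  have R': "valid_profile R'" unfolding R'_def by (rule valid_upd[OF R(1) r(2) i0])
  have dom: "dom R = dom R'" "\<forall>j\<in>dom R. j \<noteq> i \<longrightarrow> R j = R' j" using R(2) by (auto simp: R'_def)
  have "pref R' i = s" by (simp add: R'_def pref_def)
  then have "margin R' x y = 2 * h x y" for x y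
    using margin_change[OF R(1) dom(1) R(2) dom(2), of x y] diff[of x y] mR R(3) by simp
  then have "scc_margin f h = f R'" by (intro scc_margin_eq[OF f(1) R']) (simp add: fun_eq_iff)
  moreover have "scc_margin f g = f R" by (rule scc_margin_eq[OF f(1) R(1) mR])
  moreover have "\<not> fishburn (pref R i) (f R') (f R)"
    using f(2) R R' dom unfolding strategyproof_def by blast
  ultimately show ?thesis using R(3) by simp
qed

lemma no_key_manipulation:
  fixes f :: "'a::finite profile \<Rightarrow> 'a set"
  assumes f: "pairwise_scc f" "strategyproof f" and g: "skew g"
    and diff: "\<And>e x y. vote (key_ord e k') x y - vote (key_ord e k) x y = 2 * (h x y - g x y)"
    and "scc_margin f g = X" "scc_margin f h = W"
    and "\<And>a b. a \<in> W - X \<Longrightarrow> b \<in> X \<Longrightarrow> k a < k b"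
    and "\<And>a b. a \<in> W \<Longrightarrow> b \<in> X - W \<Longrightarrow> k a < k b"
  shows "W = X"
proof -
  obtain e :: "'a \<Rightarrow> nat" where e: "inj e"
    using finite_imp_inj_to_nat_seg[of "UNIV :: 'a set"] by auto
  have "\<not> fishburn (key_ord e k) (scc_margin f h) (scc_margin f g)"
    by (rule no_manipulation[OF f g strict_linear_key_ord[OF e] strict_linear_key_ord[OF e] diff])
  then show ?thesis using assms(5-8) by (auto simp: fishburn_def set_pref_def key_ord_def)
qed

lemma swap_scc:
  fixes f :: "'a::finite profile \<Rightarrow> 'a set"
  assumes f: "pairwise_scc f" "strategyproof f" and g: "skew g" and ne: "x \<noteq> y"
    and X: "scc_margin f g = X" and W: "scc_margin f (shift g {x} {y}) = W"
  shows "W = X \<or> x \<notin> X \<and> x \<in> W \<and> y \<in> X \<or> x \<in> X \<and> x \<in> W \<and> y \<in> X \<and> y \<notin> W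
        \<or> x \<in> X \<and> x \<notin> W \<and> y \<notin> X \<and> y \<in> W \<and> X \<inter> W \<noteq> {}"
proof -
  \<comment> \<open>Blocks that make \<open>W\<close> Fishburn-preferred to \<open>X\<close>: first
    \<open>W - X\<close>, then \<open>X \<inter> W\<close>, then \<open>X - W\<close>. Alternatives
    outside both sets share block 0.\<close>
  define c where "c = (\<lambda>w. if w \<in> X then if w \<in> W then 1 else 2 else (0::nat))"
  \<comment> \<open>\<open>y\<close> and then \<open>x\<close> are placed side by side after block
    \<open>n\<close>; the factor 10 leaves room between the blocks.\<close>
  define k where "k = (\<lambda>n w. if w = y then 10 * n + 8 else if w = x then 10 * n + 9 else 10 * c w)"
  have place: "W = X"
    if "\<And>a b. a \<in> W - X \<Longrightarrow> b \<in> X \<Longrightarrow> k n a < k n b" "\<And>a b. a \<in> W \<Longrightarrow> b \<in> X - W \<Longrightarrow> k n a < k n b" for n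
  proof (rule no_key_manipulation[OF f g _ X W that])
    show "vote (key_ord e ((k n)(x := k n y, y := k n x))) a b - vote (key_ord e (k n)) a b
        = 2 * (shift g {x} {y} a b - g a b)" for e a b
    proof (rule vote_key_ord_swap)
      show "k n y < k n x" using ne by (simp add: k_def)
      show "k n w < k n y \<or> k n x < k n w" if "w \<noteq> x" "w \<noteq> y" for w
        using that ne by (auto simp: k_def; presburger)
    qed
  qed
  \<comment> \<open>This position respects the blocks if \<open>y\<close> belongs to block
    \<open>n\<close> and \<open>x\<close> to block \<open>n\<close> or \<open>n + 1\<close>, or if
    block 1 is empty and \<open>n = 0\<close>. Alternatives outside \<open>X \<union> W\<close> may
    stand anywhere.\<close>
  have fits: "W = X"
    if yn: "y \<in> X \<union> W \<Longrightarrow> c y = n"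
      and xn: "x \<in> X \<union> W \<Longrightarrow> c x = n \<or> c x = n + 1 \<or> n = 0 \<and> X \<inter> W = {}" for n
  proof (rule place[of n])
    have ky: "k n y = 10 * n + 8" and kx: "k n x = 10 * n + 9" using ne by (simp_all add: k_def)
    have kw: "k n w = 10 * c w" if "w \<noteq> x" "w \<noteq> y" for w using that by (simp add: k_def)
    show "k n a < k n b" if a: "a \<in> W - X" and b: "b \<in> X" for a b
    proof -
      have c: "c a = 0" "c b \<ge> 1" "a \<noteq> b" using a b by (auto simp: c_def)
      consider "a = y" | "a = x" | "a \<noteq> x" "a \<noteq> y" by blast
      then show ?thesis
      proof cases
        case 1
        then have "n = 0" using yn a c(1) by simp
        then show ?thesis using 1 ky kx kw[of b] c by (cases "b = x") auto
      next
        case 2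
        then have "n = 0" using xn a c(1) by auto
        moreover have "b \<noteq> y" using yn b c(2) calculation by auto
        ultimately show ?thesis using 2 kx kw[of b] c by auto
      next
        case 3
        then show ?thesis using ky kx kw[of a] kw[of b] c by (cases "b = x"; cases "b = y") auto
      qed
    qed
    show "k n a < k n b" if a: "a \<in> W" and b: "b \<in> X - W" for a b
    proof -
      have c: "c a \<le> 1" "c b = 2" "a \<noteq> b" using a b by (auto simp: c_def)
      have disj: "c a = 0" if "X \<inter> W = {}" using a that by (auto simp: c_def)
      consider "a = y" | "a = x" | "a \<noteq> x" "a \<noteq> y" by blast
      then show ?thesis
      proof cases
        case 1
        then have "n \<le> 1" using yn a c(1) by simp
        then show ?thesis using 1 ky kx kw[of b] c by (cases "b = x") auto
      next
        case 2
        then have "n \<le> 1" using xn a c(1) by auto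
        moreover have "b \<noteq> y" using yn b c(2) calculation by auto
        ultimately show ?thesis using 2 kx kw[of b] c by auto
      next
        case 3
        show ?thesis
        proof (cases "b = x")
          case True
          then have "c x = n \<or> c x = n + 1 \<or> n = 0 \<and> c a = 0" using xn b disj by auto
          then show ?thesis using True kx kw[OF 3] c by auto
        next
          case False
          then show ?thesis using 3 ky kw[of a] kw[of b] c yn b by (cases "b = y") auto
        qed
      qed
    qed
  qed
  have cX: "c w = (if w \<in> X then if w \<in> W then 1 else 2 else 0)" for w by (simp add: c_def)
  show ?thesis
  proof (cases "y \<in> X \<union> W")
    case True
    then show ?thesis using fits[of "c y"] cX[of x] cX[of y] by (cases "x \<in> X"; cases "x \<in> W"; cases "y \<in> X"; cases "y \<in> W"; simp; blast?)
  next
    case False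
    then show ?thesis using fits[of "c x"] by simp
  qed
qed

lemma lift_scc:
  fixes f :: "'a::finite profile \<Rightarrow> 'a set"
  assumes f: "pairwise_scc f" "strategyproof f" and g: "skew g" and X: "scc_margin f g = X"
  shows "scc_margin f (shift g X (- X)) = X"
proof -
  define W where "W = scc_margin f (shift g X (- X))"
  \<comment> \<open>The voter has \<open>X\<close> at the bottom and moves it to the top; the keys
    make \<open>W\<close> Fishburn-preferred to \<open>X\<close> unless both coincide.\<close>
  define k where "k = (\<lambda>w. if w \<in> X then if w \<in> W then 2 else 3 else if w \<in> W then 0 else (1::nat))"
  define k' where "k' = (\<lambda>w. if w \<in> X then if w \<in> W then 0 else 1 else if w \<in> W then 2 else (3::nat))"
  have "W = X"
  proof (rule no_key_manipulation[OF f g _ X])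
    show "vote (key_ord e k') a b - vote (key_ord e k) a b = 2 * (shift g X (- X) a b - g a b)" for e a b
      by (cases "a \<in> X"; cases "b \<in> X"; cases "a \<in> W"; cases "b \<in> W")
        (simp_all add: vote_def key_ord_def shift_def k_def k'_def)
  qed (auto simp: W_def[symmetric] k_def)
  then show ?thesis by (simp add: W_def)
qed

lemma choice_scc:
  fixes f :: "'a::finite profile \<Rightarrow> 'a set"
  assumes f: "is_SCC f" "pairwise_scc f" "non_imposing f" "homogeneous f" "neutral f" "strategyproof f"
  shows "choice (scc_margin f)"
proof
  fix g :: "'a \<Rightarrow> 'a \<Rightarrow> int" assume g: "skew g"
  obtain R where R: "valid_profile R" "margin R = (\<lambda>x y. 2 * g x y)" using realizable[OF g] by blast
  have Fg: "scc_margin f g = f R" by (rule scc_margin_eq[OF f(2) R])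
  show "scc_margin f g \<noteq> {}" using Fg R(1) f(1) by (simp add: is_SCC_def)
  show "scc_margin f (\<lambda>x y. int k * g x y) = scc_margin f g" if k: "k > 0" for k
  proof -
    obtain R' where R': "valid_profile R'" "copies k R R'" "margin R' = (\<lambda>x y. int k * margin R x y)"
      using copies_exist[OF R(1) k] by blast
    have "f R' = f R"
      using f(4)[unfolded homogeneous_def, rule_format, of R R' k] R(1) R'(1,2) k by simp
    moreover have "scc_margin f (\<lambda>x y. int k * g x y) = f R'"
      by (rule scc_margin_eq[OF f(2) R'(1)]) (simp add: R'(3) R(2) mult.left_commute)
    ultimately show ?thesis using Fg by simp
  qed
  show "scc_margin f (\<lambda>x y. g (p x) (p y)) = {x. p x \<in> scc_margin f g}" if p: "bij p" for p
  proof -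
    \<comment> \<open>Preferences are pulled back along \<open>p\<close>, so \<open>inv p\<close> is
      the permutation that leads from \<open>R\<close> to \<open>R'\<close>.\<close>
    define R' where "R' = (\<lambda>i. map_option (\<lambda>r. inv_image r p) (R i))"
    have inj: "inj p" using p by (rule bij_is_inj)
    have dom: "dom R' = dom R" by (auto simp: R'_def)
    have pref: "pref R' i = inv_image (pref R i) p" if "i \<in> dom R" for i
      using that by (auto simp: pref_def R'_def)
    have valid: "valid_profile R'"
      using R(1) dom pref strict_linear_inv_image[OF _ inj] by (simp add: valid_profile_def pref_def)
    have "margin R' x y = margin R (p x) (p y)" for x y
      unfolding margin_sum[OF valid_finite[OF R(1)]] margin_sum[OF valid_finite[OF valid]] dom
      using pref by (intro sum.cong) (auto simp: vote_def)
    then have "scc_margin f (\<lambda>x y. g (p x) (p y)) = f R'"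
      by (intro scc_margin_eq[OF f(2) valid]) (simp add: R(2) fun_eq_iff)
    also have "f R' = inv p ` f R"
    proof (rule f(5)[unfolded neutral_def, rule_format], intro conjI ballI allI)
      show "valid_profile R" "valid_profile R'" by (fact R(1), fact valid)
      show "dom R = dom R'" using dom by simp
      show "bij (inv p)" by (rule bij_imp_bij_inv[OF p])
      show "(x, y) \<in> pref R i \<longleftrightarrow> (inv p x, inv p y) \<in> pref R' i" if "i \<in> dom R" for i x y
        using pref[OF that] p by (simp add: bij_is_surj surj_f_inv_f)
    qed
    also have "\<dots> = {x. p x \<in> f R}"
      using bij_image_Collect_eq[OF bij_imp_bij_inv[OF p], of "\<lambda>x. x \<in> f R"] inv_inv_eq[OF p] by simp
    finally show ?thesis using Fg by simp
  qed
  show "scc_margin f (shift g (scc_margin f g) (- scc_margin f g)) = scc_margin f g"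
    by (rule lift_scc[OF f(2,6) g refl])
  fix x y :: 'a assume "x \<noteq> y"
  then show "scc_margin f (shift g {x} {y}) = scc_margin f g
        \<or> x \<notin> scc_margin f g \<and> x \<in> scc_margin f (shift g {x} {y}) \<and> y \<in> scc_margin f g
        \<or> x \<in> scc_margin f g \<and> x \<in> scc_margin f (shift g {x} {y}) \<and> y \<in> scc_margin f g \<and> y \<notin> scc_margin f (shift g {x} {y})
        \<or> x \<in> scc_margin f g \<and> x \<notin> scc_margin f (shift g {x} {y}) \<and> y \<notin> scc_margin f g \<and> y \<in> scc_margin f (shift g {x} {y})
            \<and> scc_margin f g \<inter> scc_margin f (shift g {x} {y}) \<noteq> {}"
    by (rule swap_scc[OF f(2,6) g _ refl refl])
next
  fix x
  obtain R where R: "valid_profile R" "f R = {x}" using f(3) by (auto simp: non_imposing_def)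
  then have "scc_margin f (margin R) = {x}" using scc_margin_profile[OF f(2,4) R(1)] by simp
  then show "\<exists>g. skew g \<and> scc_margin f g = {x}" using skew_margin by blast
qed

section \<open>Robust dominant set rules are strategyproof\<close>

lemma robust_dominant_strategyproof:
  assumes dom: "dominant_set_rule f" and rob: "robust f"
  shows "strategyproof f"
  unfolding strategyproof_def
proof
  assume "\<exists>R R' i. valid_profile R \<and> valid_profile R' \<and> dom R = dom R' \<and> i \<in> dom R \<and>
      (\<forall>j\<in>dom R. j \<noteq> i \<longrightarrow> R j = R' j) \<and> fishburn (pref R i) (f R') (f R)"
  then obtain R R' i where R: "valid_profile R" "valid_profile R'" "dom R = dom R'" "i \<in> dom R"
      "\<forall>j\<in>dom R. j \<noteq> i \<longrightarrow> R j = R' j" and fish: "fishburn (pref R i) (f R') (f R)" by blast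
  let ?X = "f R" and ?Y = "f R'"
  have fb: "?Y \<noteq> ?X" "\<And>a b. a \<in> ?Y - ?X \<Longrightarrow> b \<in> ?X \<Longrightarrow> (a, b) \<in> pref R i"
      "\<And>a b. a \<in> ?Y \<Longrightarrow> b \<in> ?X - ?Y \<Longrightarrow> (a, b) \<in> pref R i"
    using fish by (auto simp: fishburn_def set_pref_def)
  have slo: "strict_linear_order (pref R i)" "strict_linear_order (pref R' i)"
    using R by (auto simp: valid_profile_def pref_def)
  \<comment> \<open>The sincere ballot already supports \<open>a\<close> against \<open>b\<close>,
    so a manipulation cannot raise this margin.\<close>
  have best: "margin R' a b \<le> margin R a b" if "(a, b) \<in> pref R i" for a b
  proof -
    have "(b, a) \<notin> pref R i"
      using that slo(1) unfolding strict_linear_order_on_def irrefl_def by (meson transD)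
    then have "vote (pref R i) a b = 1" using that by (simp add: vote_def)
    moreover have "vote (pref R' i) a b \<le> 1" by (simp add: vote_def)
    ultimately show ?thesis using margin_change[OF R(1,3,4,5), of a b] by simp
  qed
  have mirror: "margin S b a = - margin S a b" for S :: "'a profile" and a b by (rule skewD[OF skew_margin])
  have dX: "x \<in> ?X \<Longrightarrow> z \<notin> ?X \<Longrightarrow> margin R x z > 0"
    and dY: "x \<in> ?Y \<Longrightarrow> z \<notin> ?Y \<Longrightarrow> margin R' x z > 0" for x z
    using dom R(1,2) by (auto simp: dominant_set_rule_def dominant_iff dom_in_def)
  have ne: "?X \<noteq> {}" "?Y \<noteq> {}"
    using dom R(1,2) by (auto simp: dominant_set_rule_def dominant_def)
  consider "?Y \<subseteq> ?X" | "?X \<subseteq> ?Y" | x y where "x \<in> ?X - ?Y" "y \<in> ?Y - ?X" by blast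
  then show False
  proof cases
    case 1
    \<comment> \<open>\<open>?Y\<close> beats \<open>?X - ?Y\<close> in \<open>R'\<close>, hence
      also under the sincere ballot. So \<open>?Y\<close> is dominant in \<open>R\<close>, and
      robustness forces \<open>?X \<subseteq> ?Y\<close>.\<close>
    have "margin R a b > 0" if "a \<in> ?Y" "b \<notin> ?Y" for a b
    proof (cases "b \<in> ?X")
      case True
      then show ?thesis using best[OF fb(3)] dY that by (metis DiffI order_less_le_trans)
    qed (use dX 1 that in blast)
    then have "dominant R ?Y" using ne by (auto simp: dominant_iff dom_in_def)
    then show False using rob R(1,2) 1 fb(1) unfolding robust_def by blast
  next
    case 2
    \<comment> \<open>Entering alternatives cannot gain on \<open>?X\<close>, which therefore stays
      dominant in \<open>R'\<close>; robustness forces \<open>?Y \<subseteq> ?X\<close>.\<close>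
    have "margin R' a b > 0" if "a \<in> ?X" "b \<notin> ?X" for a b
    proof (cases "b \<in> ?Y")
      case True
      then have "margin R' b a \<le> margin R b a" using best[OF fb(2)] that by blast
      then show ?thesis using dX[OF that] mirror[of R a b] mirror[of R' a b] by simp
    qed (use dY 2 that in blast)
    then have "dominant R' ?X" using ne by (auto simp: dominant_iff dom_in_def)
    then show False using rob R(1,2) 2 fb(1) unfolding robust_def by blast
  next
    case 3
    then have "margin R' y x \<le> margin R y x" using best[OF fb(2)] by blast
    moreover have "margin R' y x > 0" "margin R x y > 0" using dX dY 3 by auto
    ultimately show False using mirror[of R x y] by simp
  qed
qed

theorem theorem1:
  fixes f :: "('a::finite) profile \<Rightarrow> 'a set"
  assumes "is_SCC f" and "pairwise_scc f" and "non_imposing f"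
    and "homogeneous f" and "neutral f"
  shows "strategyproof f \<longleftrightarrow> dominant_set_rule f \<and> robust f"
proof
  assume "strategyproof f"
  then interpret choice "scc_margin f" using choice_scc assms by blast
  have eq: "f R = scc_margin f (margin R)" if "valid_profile R" for R
    using scc_margin_profile[OF assms(2,4) that] by simp
  have "dominant_set_rule f"
    using dominant_F[OF skew_margin] eq by (simp add: dominant_set_rule_def dominant_iff)
  moreover have "robust f"
    unfolding robust_def dominant_iff
  proof (intro allI impI)
    fix R R' :: "'a profile"
    assume "valid_profile R \<and> valid_profile R' \<and> dom_in (margin R') (f R)"
    then show "f R' \<subseteq> f R"
      using robust_F[OF skew_margin skew_margin, of R' R] eq[of R] eq[of R'] by simp
  qed
  ultimately show "dominant_set_rule f \<and> robust f" ..
next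
  assume "dominant_set_rule f \<and> robust f"
  then show "strategyproof f" using robust_dominant_strategyproof by blast
qed

end
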